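(* Let $(M,\varphi,\xi,\eta,g)$ be a $(2n+1)$-dimensional almost paracontact almost paracomplex Riemannian manifold, let $\alpha,\beta$ be smooth functions on $M$, and let $\overline{\nabla}$ be the generalized symmetric metric connection on $M$ determined by $\alpha,\beta$. Then the divergence, Hessian and Laplace operators $\overline{\mathrm{div}},\overline{\mathrm{Hess}},\overline{\Delta}$ with respect to $\overline{\nabla}$ and the corresponding operators $\mathrm{div},\mathrm{Hess},\Delta$ with respect to the Levi-Civita connection satisfy, for all vector fields $x,y$ and all smooth functions $f$ on $M$: $$\overline{\mathrm{div}}(x)=\mathrm{div}(x)-2n\alpha\,\eta(x),$$ $$\overline{\mathrm{Hess}}f(x,y)=\mathrm{Hess}f(x,y)+\alpha\,(xf)\,\eta(y)-\alpha\,(\xi f)\,g(x,y)+\beta\,((\varphi x)f)\,\eta(y)-\beta\,(\xi f)\,g(\varphi x,y),$$ $$\overline{\Delta}f=\Delta f-2n\alpha\,\xi f.$$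
   Context: An almost paracontact almost paracomplex Riemannian manifold (apapR manifold) $(M,\varphi,\xi,\eta,g)$ is a differentiable manifold $M$ of dimension $2n+1$ with a $(1,1)$-tensor field $\varphi$, a vector field $\xi$, a $1$-form $\eta$ and a Riemannian metric $g$ such that, for all vector fields $x,y$: $\eta(\xi)=1$, $\varphi^2x=x-\eta(x)\xi$, $\varphi\xi=0$, $g(\varphi x,\varphi y)=g(x,y)-\eta(x)\eta(y)$, $\mathrm{tr}\,\varphi=0$. Consequently $g(x,\xi)=\eta(x)$ and $g(x,\varphi y)=g(\varphi x,y)$. With $\nabla$ the Levi-Civita connection of $g$, the generalized symmetric metric connection determined by smooth functions $\alpha,\beta$ is $$\overline{\nabla}_xy=\nabla_xy+\alpha\{g(x,y)\xi-\eta(y)x\}+\beta\{g(\varphi x,y)\xi-\eta(y)\varphi x\}.$$ Operators: $\overline{\mathrm{div}}(x)=\sum_{i=0}^{2n}g(\overline{\nabla}_{e_i}x,e_i)$ for an orthonormal basis $\{e_0=\xi,e_1,\ldots,e_{2n}\}$ of the tangent space; $\overline{\mathrm{Hess}}f(x,y)=g(\overline{\nabla}_x\,\mathrm{grad}f,y)$, where $g(\mathrm{grad}f,x)=x(f)$; $\overline{\Delta}f=\overline{\mathrm{div}}(\mathrm{grad}f)$. The operators $\mathrm{div},\mathrm{Hess},\Delta$ are defined in the same way with $\nabla$. *)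

theory Defs
  imports "HOL-Analysis.Analysis" "HOL-Library.Function_Algebras"
begin

text \<open>Tangent vectors will be real-valued functionals, so their vector space structure is the
  pointwise one, extending the pointwise addition provided by the library.\<close>

instantiation "fun" :: (type, scaleR) scaleR
begin

definition scaleR_fun_def: "scaleR c f = (\<lambda>x. c *\<^sub>R f x)"

instance ..

end

instance "fun" :: (type, real_vector) real_vector
  by standard (auto simp: scaleR_fun_def fun_eq_iff scaleR_add_right scaleR_add_left)

primrec Ck_on :: "nat \<Rightarrow> 'a::real_normed_vector set \<Rightarrow> ('a \<Rightarrow> 'b::real_normed_vector) \<Rightarrow> bool" where
  "Ck_on 0 S f \<longleftrightarrow> continuous_on S f"
| "Ck_on (Suc k) S f \<longleftrightarrow>
     (\<forall>x\<in>S. f differentiable (at x)) \<and> (\<forall>v. Ck_on k S (\<lambda>x. frechet_derivative f (at x) v))"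

text \<open>Only used for open \<open>S\<close>.\<close>

definition smooth_map_on :: "'a::real_normed_vector set \<Rightarrow> ('a \<Rightarrow> 'b::real_normed_vector) \<Rightarrow> bool" where
  "smooth_map_on S f \<longleftrightarrow> (\<forall>k. Ck_on k S f)"

text \<open>A chart is a pair of its domain and its coordinate map (whose values outside the domain are
  irrelevant).\<close>

type_synonym ('m, 'e) chart = "'m set \<times> ('m \<Rightarrow> 'e)"

text \<open>The underlying set of the manifold is the whole type \<open>'m\<close>, its model space is \<open>'e\<close>, so
  that its dimension is \<open>DIM('e)\<close>.\<close>

locale smooth_manifold =
  fixes A :: "('m::{t2_space, second_countable_topology}, 'e::euclidean_space) chart set"
  assumes chart: "\<And>U \<psi>. (U, \<psi>) \<in> A \<Longrightarrow>
      open U \<and> open (\<psi> ` U) \<and> homeomorphism U (\<psi> ` U) \<psi> (inv_into U \<psi>)"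
    and covering: "(\<Union>(U, \<psi>)\<in>A. U) = UNIV"
    and compatible: "\<And>U \<psi> V \<theta>. (U, \<psi>) \<in> A \<Longrightarrow> (V, \<theta>) \<in> A \<Longrightarrow>
      smooth_map_on (\<psi> ` (U \<inter> V)) (\<theta> \<circ> inv_into U \<psi>)"

definition smooth_fun_on ::
    "('m::topological_space, 'e::euclidean_space) chart set \<Rightarrow> 'm set \<Rightarrow> ('m \<Rightarrow> real) \<Rightarrow> bool" where
  "smooth_fun_on A U f \<longleftrightarrow>
     (\<forall>(V, \<psi>)\<in>A. smooth_map_on (\<psi> ` (V \<inter> U)) (f \<circ> inv_into V \<psi>))"

definition smooth_near ::
    "('m::topological_space, 'e::euclidean_space) chart set \<Rightarrow> 'm \<Rightarrow> ('m \<Rightarrow> real) \<Rightarrow> bool" where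
  "smooth_near A p f \<longleftrightarrow> (\<exists>U. open U \<and> p \<in> U \<and> smooth_fun_on A U f)"

type_synonym 'm tvec = "('m \<Rightarrow> real) \<Rightarrow> real"
type_synonym 'm vfield = "'m \<Rightarrow> 'm tvec"

definition smooth_curve ::
    "('m::topological_space, 'e::euclidean_space) chart set \<Rightarrow> real \<Rightarrow> (real \<Rightarrow> 'm) \<Rightarrow> bool" where
  "smooth_curve A \<epsilon> \<gamma> \<longleftrightarrow> continuous_on {-\<epsilon><..<\<epsilon>} \<gamma> \<and>
     (\<forall>(U, \<psi>)\<in>A. smooth_map_on ({-\<epsilon><..<\<epsilon>} \<inter> \<gamma> -` U) (\<psi> \<circ> \<gamma>))"

text \<open>The velocity at time 0 is the operator sending a function \<open>f\<close> that is smooth near \<open>\<gamma> 0\<close> to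
  the derivative of \<open>f \<circ> \<gamma>\<close> at 0; it is set to 0 on all other functions, so that tangent
  vectors are equal as soon as they agree on the functions smooth near the base point.\<close>

definition velocity ::
    "('m::topological_space, 'e::euclidean_space) chart set \<Rightarrow> (real \<Rightarrow> 'm) \<Rightarrow> 'm tvec" where
  "velocity A \<gamma> = (\<lambda>f. if smooth_near A (\<gamma> 0) f then deriv (f \<circ> \<gamma>) 0 else 0)"

definition tangent_space ::
    "('m::topological_space, 'e::euclidean_space) chart set \<Rightarrow> 'm \<Rightarrow> 'm tvec set" where
  "tangent_space A p = {velocity A \<gamma> | \<gamma>. \<gamma> 0 = p \<and> (\<exists>\<epsilon>>0. smooth_curve A \<epsilon> \<gamma>)}"

text \<open>Smooth vector fields on an open set \<open>U\<close>. The derivative of \<open>f\<close> in the direction of \<open>X\<close> is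
  the function \<open>\<lambda>p. X p f\<close>.\<close>

definition vector_field_on ::
    "('m::topological_space, 'e::euclidean_space) chart set \<Rightarrow> 'm set \<Rightarrow> 'm vfield \<Rightarrow> bool" where
  "vector_field_on A U X \<longleftrightarrow> (\<forall>p\<in>U. X p \<in> tangent_space A p) \<and>
     (\<forall>V f. open V \<and> V \<subseteq> U \<and> smooth_fun_on A V f \<longrightarrow> smooth_fun_on A V (\<lambda>p. X p f))"

abbreviation vector_field ::
    "('m::topological_space, 'e::euclidean_space) chart set \<Rightarrow> 'm vfield \<Rightarrow> bool" where
  "vector_field A \<equiv> vector_field_on A UNIV"

definition lie_bracket ::
    "('m::topological_space, 'e::euclidean_space) chart set \<Rightarrow> 'm vfield \<Rightarrow> 'm vfield \<Rightarrow> 'm vfield" where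
  "lie_bracket A X Y = (\<lambda>p f. if smooth_near A p f
     then X p (\<lambda>q. Y q f) - Y p (\<lambda>q. X q f) else 0)"

definition linear_on_subspace ::
    "'a::real_vector set \<Rightarrow> ('a \<Rightarrow> 'b::real_vector) \<Rightarrow> bool" where
  "linear_on_subspace V L \<longleftrightarrow>
     (\<forall>v\<in>V. \<forall>w\<in>V. \<forall>a b. L (a *\<^sub>R v + b *\<^sub>R w) = a *\<^sub>R L v + b *\<^sub>R L w)"

definition one_form ::
    "('m::topological_space, 'e::euclidean_space) chart set \<Rightarrow> ('m \<Rightarrow> 'm tvec \<Rightarrow> real) \<Rightarrow> bool" where
  "one_form A \<omega> \<longleftrightarrow> (\<forall>p. linear_on_subspace (tangent_space A p) (\<omega> p)) \<and>
     (\<forall>U X. open U \<and> vector_field_on A U X \<longrightarrow> smooth_fun_on A U (\<lambda>p. \<omega> p (X p)))"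

definition tensor_field_1_1 ::
    "('m::topological_space, 'e::euclidean_space) chart set \<Rightarrow> ('m \<Rightarrow> 'm tvec \<Rightarrow> 'm tvec) \<Rightarrow> bool" where
  "tensor_field_1_1 A \<phi> \<longleftrightarrow>
     (\<forall>p. linear_on_subspace (tangent_space A p) (\<phi> p) \<and>
          \<phi> p ` tangent_space A p \<subseteq> tangent_space A p) \<and>
     (\<forall>U X. open U \<and> vector_field_on A U X \<longrightarrow> vector_field_on A U (\<lambda>p. \<phi> p (X p)))"

definition riemannian_metric ::
    "('m::topological_space, 'e::euclidean_space) chart set \<Rightarrow>
      ('m \<Rightarrow> 'm tvec \<Rightarrow> 'm tvec \<Rightarrow> real) \<Rightarrow> bool" where
  "riemannian_metric A g \<longleftrightarrow>
     (\<forall>p. \<forall>v\<in>tangent_space A p.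
        linear_on_subspace (tangent_space A p) (g p v) \<and>
        (\<forall>w\<in>tangent_space A p. g p v w = g p w v) \<and>
        (v \<noteq> 0 \<longrightarrow> g p v v > 0)) \<and>
     (\<forall>U X Y. open U \<and> vector_field_on A U X \<and> vector_field_on A U Y \<longrightarrow>
        smooth_fun_on A U (\<lambda>p. g p (X p) (Y p)))"

text \<open>For finite-dimensional \<open>V\<close> mapped into itself by a linear \<open>L\<close>, the sum does not depend on
  the basis chosen. The same holds for the adapted bases in \<open>divergence\<close> below.\<close>

definition trace_on :: "'a::real_vector set \<Rightarrow> ('a \<Rightarrow> 'a) \<Rightarrow> real" where
  "trace_on V L = (let B = (SOME B. independent B \<and> span B = V)
     in \<Sum>b\<in>B. representation B (L b) b)"

locale apapR_manifold = smooth_manifold A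
  for A :: "('m::{t2_space, second_countable_topology}, 'e::euclidean_space) chart set" +
  fixes n :: nat
    and \<phi> :: "'m \<Rightarrow> 'm tvec \<Rightarrow> 'm tvec"
    and \<xi> :: "'m vfield"
    and \<eta> :: "'m \<Rightarrow> 'm tvec \<Rightarrow> real"
    and g :: "'m \<Rightarrow> 'm tvec \<Rightarrow> 'm tvec \<Rightarrow> real"
  assumes dimension: "DIM('e) = 2 * n + 1"
    and phi_tensor: "tensor_field_1_1 A \<phi>"
    and xi_field: "vector_field A \<xi>"
    and eta_form: "one_form A \<eta>"
    and metric: "riemannian_metric A g"
    and eta_xi: "\<And>p. \<eta> p (\<xi> p) = 1"
    and phi_phi: "\<And>p v. v \<in> tangent_space A p \<Longrightarrow> \<phi> p (\<phi> p v) = v - \<eta> p v *\<^sub>R \<xi> p"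
    and phi_xi: "\<And>p. \<phi> p (\<xi> p) = 0"
    and metric_phi: "\<And>p v w. v \<in> tangent_space A p \<Longrightarrow> w \<in> tangent_space A p \<Longrightarrow>
      g p (\<phi> p v) (\<phi> p w) = g p v w - \<eta> p v * \<eta> p w"
    and trace_phi: "\<And>p. trace_on (tangent_space A p) (\<phi> p) = 0"

text \<open>A connection takes a point \<open>p\<close>, a tangent vector at \<open>p\<close> and a global vector field to a tangent
  vector at \<open>p\<close>; the covariant derivative of \<open>Y\<close> along a vector field \<open>X\<close> is
  \<open>\<lambda>p. D p (X p) Y\<close>.\<close>

type_synonym 'm connection = "'m \<Rightarrow> 'm tvec \<Rightarrow> 'm vfield \<Rightarrow> 'm tvec"

definition affine_connection ::
    "('m::topological_space, 'e::euclidean_space) chart set \<Rightarrow> 'm connection \<Rightarrow> bool" where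
  "affine_connection A D \<longleftrightarrow>
     (\<forall>X Y. vector_field A X \<and> vector_field A Y \<longrightarrow> vector_field A (\<lambda>p. D p (X p) Y)) \<and>
     (\<forall>p Y. vector_field A Y \<longrightarrow>
        linear_on_subspace (tangent_space A p) (\<lambda>v. D p v Y) \<and>
        (\<forall>v\<in>tangent_space A p. D p v Y \<in> tangent_space A p)) \<and>
     (\<forall>p Y Z. \<forall>v\<in>tangent_space A p. vector_field A Y \<and> vector_field A Z \<longrightarrow>
        D p v (\<lambda>q. Y q + Z q) = D p v Y + D p v Z) \<and>
     (\<forall>p Y f. \<forall>v\<in>tangent_space A p. vector_field A Y \<and> smooth_fun_on A UNIV f \<longrightarrow>
        D p v (\<lambda>q. f q *\<^sub>R Y q) = v f *\<^sub>R Y p + f p *\<^sub>R D p v Y)"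

definition levi_civita ::
    "('m::topological_space, 'e::euclidean_space) chart set \<Rightarrow>
      ('m \<Rightarrow> 'm tvec \<Rightarrow> 'm tvec \<Rightarrow> real) \<Rightarrow> 'm connection \<Rightarrow> bool" where
  "levi_civita A g D \<longleftrightarrow> affine_connection A D \<and>
     (\<forall>X Y p. vector_field A X \<and> vector_field A Y \<longrightarrow>
        D p (X p) Y - D p (Y p) X = lie_bracket A X Y p) \<and>
     (\<forall>X Y Z p. vector_field A X \<and> vector_field A Y \<and> vector_field A Z \<longrightarrow>
        X p (\<lambda>q. g q (Y q) (Z q)) = g p (D p (X p) Y) (Z p) + g p (Y p) (D p (X p) Z))"

definition gen_sym_metric_connection ::
    "('m \<Rightarrow> 'm tvec \<Rightarrow> 'm tvec) \<Rightarrow> 'm vfield \<Rightarrow> ('m \<Rightarrow> 'm tvec \<Rightarrow> real) \<Rightarrow>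
      ('m \<Rightarrow> 'm tvec \<Rightarrow> 'm tvec \<Rightarrow> real) \<Rightarrow> ('m \<Rightarrow> real) \<Rightarrow> ('m \<Rightarrow> real) \<Rightarrow>
      'm connection \<Rightarrow> 'm connection" where
  "gen_sym_metric_connection \<phi> \<xi> \<eta> g \<alpha> \<beta> D = (\<lambda>p v Y. D p v Y
     + \<alpha> p *\<^sub>R (g p v (Y p) *\<^sub>R \<xi> p - \<eta> p (Y p) *\<^sub>R v)
     + \<beta> p *\<^sub>R (g p (\<phi> p v) (Y p) *\<^sub>R \<xi> p - \<eta> p (Y p) *\<^sub>R \<phi> p v))"

definition adapted_orthonormal_basis ::
    "('m::topological_space, 'e::euclidean_space) chart set \<Rightarrow> nat \<Rightarrow> 'm vfield \<Rightarrow>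
      ('m \<Rightarrow> 'm tvec \<Rightarrow> 'm tvec \<Rightarrow> real) \<Rightarrow> 'm \<Rightarrow> (nat \<Rightarrow> 'm tvec) \<Rightarrow> bool" where
  "adapted_orthonormal_basis A n \<xi> g p e \<longleftrightarrow> e 0 = \<xi> p \<and>
     (\<forall>i\<le>2*n. \<forall>j\<le>2*n. g p (e i) (e j) = (if i = j then 1 else 0)) \<and>
     span (e ` {..2*n}) = tangent_space A p"

definition divergence ::
    "('m::topological_space, 'e::euclidean_space) chart set \<Rightarrow> nat \<Rightarrow> 'm vfield \<Rightarrow>
      ('m \<Rightarrow> 'm tvec \<Rightarrow> 'm tvec \<Rightarrow> real) \<Rightarrow> 'm connection \<Rightarrow> 'm vfield \<Rightarrow> 'm \<Rightarrow> real" where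
  "divergence A n \<xi> g D X p = (let e = (SOME e. adapted_orthonormal_basis A n \<xi> g p e)
     in \<Sum>i\<le>2*n. g p (D p (e i) X) (e i))"

definition gradient ::
    "('m::topological_space, 'e::euclidean_space) chart set \<Rightarrow>
      ('m \<Rightarrow> 'm tvec \<Rightarrow> 'm tvec \<Rightarrow> real) \<Rightarrow> ('m \<Rightarrow> real) \<Rightarrow> 'm vfield" where
  "gradient A g f p =
     (THE v. v \<in> tangent_space A p \<and> (\<forall>w\<in>tangent_space A p. g p v w = w f))"

definition hessian ::
    "('m::topological_space, 'e::euclidean_space) chart set \<Rightarrow>
      ('m \<Rightarrow> 'm tvec \<Rightarrow> 'm tvec \<Rightarrow> real) \<Rightarrow> 'm connection \<Rightarrow> ('m \<Rightarrow> real) \<Rightarrow>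
      'm vfield \<Rightarrow> 'm vfield \<Rightarrow> 'm \<Rightarrow> real" where
  "hessian A g D f X Y p = g p (D p (X p) (gradient A g f)) (Y p)"

definition laplacian ::
    "('m::topological_space, 'e::euclidean_space) chart set \<Rightarrow> nat \<Rightarrow> 'm vfield \<Rightarrow>
      ('m \<Rightarrow> 'm tvec \<Rightarrow> 'm tvec \<Rightarrow> real) \<Rightarrow> 'm connection \<Rightarrow> ('m \<Rightarrow> real) \<Rightarrow> 'm \<Rightarrow> real" where
  "laplacian A n \<xi> g D f = divergence A n \<xi> g D (gradient A g f)"

end

theory Submission
  imports Defs
begin

text \<open>The correction term of the connection is paired with the vectors of an adapted orthonormal
  frame: \<open>\<Sum> g(e\<^sub>i,x) \<eta>(e\<^sub>i) = \<eta>(x)\<close> because \<open>e\<^sub>0 = \<xi>\<close>, the \<open>\<phi>\<close>-terms vanish because \<open>\<phi>\<xi> = 0\<close> and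
  \<open>\<phi>\<close> is trace-free, which leaves \<open>\<alpha>(1 - (2n+1))\<eta>(x)\<close>. The Hessian formula is the same pairing
  with \<open>grad f\<close>. The connection is defined on smooth fields only, so the gradient must be shown to
  exist and to be smooth. Operators \<open>f \<mapsto> d(f \<circ> \<psi>\<^sup>-\<^sup>1)(v)\<close> identify each tangent space with the
  model space in a chart \<open>\<psi>\<close>, and in a smooth orthogonal frame \<open>Y\<close> the gradient is
  \<open>\<Sum> (Y\<^sub>b f / g(Y\<^sub>b,Y\<^sub>b)) Y\<^sub>b\<close>.\<close>

section \<open>Calculus of smooth maps\<close>

lemma Ck_on_subset: "Ck_on k T f \<Longrightarrow> S \<subseteq> T \<Longrightarrow> Ck_on k S f"
  by (induction k arbitrary: f) (auto intro: continuous_on_subset)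

text \<open>On an open set, functions that agree on it agree near each of its points, so they also
  have the same derivatives there.\<close>

lemma Ck_on_cong:
  assumes "open S" "\<And>x. x \<in> S \<Longrightarrow> f x = h x" "Ck_on k S f"
  shows "Ck_on k S h"
  using assms(2,3)
proof (induction k arbitrary: f h)
  case 0
  then show ?case by (auto cong: continuous_on_cong)
next
  case (Suc k)
  have eq: "frechet_derivative f (at x) = frechet_derivative h (at x)" if "x \<in> S" for x
    using Suc.prems that assms(1) by (intro frechet_derivative_transform_within_open) auto
  have "h differentiable (at x)" if "x \<in> S" for x
    using Suc.prems that has_derivative_transform_within_open[OF _ assms(1) that]
    unfolding Ck_on.simps differentiable_def by blast
  moreover have "Ck_on k S (\<lambda>x. frechet_derivative h (at x) v)" for v
  proof (rule Suc.IH)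
    show "frechet_derivative f (at x) v = frechet_derivative h (at x) v" if "x \<in> S" for x
      using eq[OF that] by simp
    show "Ck_on k S (\<lambda>x. frechet_derivative f (at x) v)"
      using Suc.prems(2) by simp
  qed
  ultimately show ?case by simp
qed

lemma Ck_on_SucD: "Ck_on (Suc k) S f \<Longrightarrow> Ck_on k S f"
proof (induction k arbitrary: f)
  case 0
  then show ?case
    by (auto intro!: continuous_at_imp_continuous_on differentiable_imp_continuous_within)
qed simp

text \<open>\<open>Ck_on\<close> refers to the chosen \<open>frechet_derivative\<close>; this rule
  lets any explicit derivative formula stand in for it, and the closure properties below supply such
  formulas.\<close>

lemma Ck_on_SucI:
  assumes "open S" "\<And>x. x \<in> S \<Longrightarrow> (f has_derivative f' x) (at x)"
    and "\<And>v. Ck_on k S (\<lambda>x. f' x v)"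
  shows "Ck_on (Suc k) S f"
  unfolding Ck_on.simps
proof (intro conjI ballI allI)
  show "f differentiable at x" if "x \<in> S" for x
    using assms(2)[OF that] unfolding differentiable_def by blast
  show "Ck_on k S (\<lambda>x. frechet_derivative f (at x) v)" for v
    using frechet_derivative_at[OF assms(2)]
    by (intro Ck_on_cong[OF assms(1) _ assms(3)[of v]]) (rule fun_cong)
qed

lemma Ck_on_SucE:
  assumes "Ck_on (Suc k) S f" "x \<in> S"
  shows "(f has_derivative frechet_derivative f (at x)) (at x)"
  using assms by (auto simp: frechet_derivative_works)

section \<open>Closure of k times differentiable maps under algebra, composition and gluing\<close>

lemma Ck_on_const: "open S \<Longrightarrow> Ck_on k S (\<lambda>_. c)"
proof (induction k arbitrary: c)
  case (Suc k)
  then show ?case by (intro Ck_on_SucI[where f' = "\<lambda>_ _. 0"]) auto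
qed simp

lemma Ck_on_bounded_linear:
  assumes "bounded_linear L" "open S" "Ck_on k S f"
  shows "Ck_on k S (\<lambda>x. L (f x))"
  using assms(3)
proof (induction k arbitrary: f)
  case 0
  then show ?case using bounded_linear.continuous_on[OF assms(1)] by simp
next
  case (Suc k)
  show ?case
    using Suc.prems
    by (intro Ck_on_SucI[where f' = "\<lambda>x v. L (frechet_derivative f (at x) v)"] assms(2)
        bounded_linear.has_derivative[OF assms(1)] Ck_on_SucE[OF Suc.prems] Suc.IH) auto
qed

lemma Ck_on_ident: "open S \<Longrightarrow> Ck_on k S (\<lambda>x. x)"
proof (cases k)
  case (Suc j)
  assume "open S"
  then show ?thesis
    unfolding Suc by (intro Ck_on_SucI[where f' = "\<lambda>_ v. v"] Ck_on_const) auto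
qed simp

lemma Ck_on_add:
  assumes "open S" "Ck_on k S f" "Ck_on k S h"
  shows "Ck_on k S (\<lambda>x. f x + h x)"
  using assms(2,3)
proof (induction k arbitrary: f h)
  case 0
  then show ?case by (auto intro: continuous_on_add)
next
  case (Suc k)
  show ?case
    using Suc.prems
    by (intro Ck_on_SucI[where f' = "\<lambda>x v. frechet_derivative f (at x) v + frechet_derivative h (at x) v"]
        assms(1) has_derivative_add Ck_on_SucE[OF Suc.prems(1)] Ck_on_SucE[OF Suc.prems(2)] Suc.IH)
       auto
qed

text \<open>Each term of the product rule keeps one factor undifferentiated;
  \<open>Ck_on_SucD\<close> lowers the order of that factor so that the induction hypothesis covers
  it.\<close>

lemma Ck_on_scaleR:
  assumes "open S" "Ck_on k S f" "Ck_on k S h"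
  shows "Ck_on k S (\<lambda>x. f x *\<^sub>R h x)"
  using assms(2,3)
proof (induction k arbitrary: f h)
  case 0
  then show ?case by (auto intro: continuous_on_scaleR)
next
  case (Suc k)
  show ?case
    using Suc.prems
    by (intro Ck_on_SucI[where f' = "\<lambda>x v. f x *\<^sub>R frechet_derivative h (at x) v
          + frechet_derivative f (at x) v *\<^sub>R h x"]
        assms(1) has_derivative_scaleR Ck_on_SucE[OF Suc.prems(1)] Ck_on_SucE[OF Suc.prems(2)]
        Ck_on_add[OF assms(1)] Suc.IH Ck_on_SucD[OF Suc.prems(1)] Ck_on_SucD[OF Suc.prems(2)])
       auto
qed

lemma Ck_on_mult:
  fixes f h :: "'a::real_normed_vector \<Rightarrow> real"
  assumes "open S" "Ck_on k S f" "Ck_on k S h"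
  shows "Ck_on k S (\<lambda>x. f x * h x)"
  using Ck_on_scaleR[OF assms] by simp

lemma Ck_on_sum:
  assumes "open S" "\<And>i. i \<in> I \<Longrightarrow> Ck_on k S (f i)"
  shows "Ck_on k S (\<lambda>x. \<Sum>i\<in>I. f i x)"
  using assms(2)
  by (induction I rule: infinite_finite_induct)
     (auto intro!: Ck_on_add Ck_on_const assms(1))

text \<open>The derivative of \<open>1/f\<close> contains \<open>1/f\<close> again, now wanted only
  to order \<open>k\<close>, which the induction hypothesis provides.\<close>

lemma Ck_on_inverse:
  fixes f :: "'a::real_normed_vector \<Rightarrow> real"
  assumes "open S" "\<And>x. x \<in> S \<Longrightarrow> f x \<noteq> 0" "Ck_on k S f"
  shows "Ck_on k S (\<lambda>x. inverse (f x))"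
  using assms(3)
proof (induction k)
  case 0
  then show ?case using assms(2) by (auto intro: continuous_on_inverse)
next
  case (Suc k)
  have IH: "Ck_on k S (\<lambda>x. inverse (f x))"
    using Suc Ck_on_SucD by blast
  have "Ck_on k S (\<lambda>x. - (inverse (f x) * frechet_derivative f (at x) v * inverse (f x)))" for v
    using Suc.prems
    by (intro Ck_on_bounded_linear[OF bounded_linear_minus[OF bounded_linear_ident]] Ck_on_mult assms(1) IH)
       auto
  then show ?case
    using Suc.prems assms(2)
    by (intro Ck_on_SucI[where f' = "\<lambda>x v. - (inverse (f x) * frechet_derivative f (at x) v * inverse (f x))"]
        assms(1) Deriv.has_derivative_inverse Ck_on_SucE[OF Suc.prems]) auto
qed

lemma Ck_on_compose:
  fixes f :: "'a::real_normed_vector \<Rightarrow> 'b::euclidean_space"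
    and h :: "'b \<Rightarrow> 'c::real_normed_vector"
  assumes "open S" "f ` S \<subseteq> T" "Ck_on k S f" "Ck_on k T h"
  shows "Ck_on k S (\<lambda>x. h (f x))"
  using assms(3,4)
proof (induction k arbitrary: h)
  case 0
  then show ?case using assms(2) by (auto intro: continuous_on_compose2)
next
  case (Suc k)
  \<comment> \<open>Expanding in the standard basis of the middle space gives a finite sum of scalar
    functions times partial derivatives of \<open>h\<close> composed with \<open>f\<close>; the
    induction hypothesis, general in \<open>h\<close>, applies to these composites.\<close>
  let ?D = "\<lambda>x v. \<Sum>b\<in>Basis. (frechet_derivative f (at x) v \<bullet> b) *\<^sub>R frechet_derivative h (at (f x)) b"
  have "((\<lambda>x. h (f x)) has_derivative ?D x) (at x)" if "x \<in> S" for x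
  proof -
    have f: "(f has_derivative frechet_derivative f (at x)) (at x)"
      using Ck_on_SucE[OF Suc.prems(1) that] .
    have h: "(h has_derivative frechet_derivative h (at (f x))) (at (f x))"
      using Ck_on_SucE[OF Suc.prems(2)] that assms(2) by blast
    interpret h: linear "frechet_derivative h (at (f x))"
      using has_derivative_linear[OF h] .
    have "frechet_derivative h (at (f x)) w
        = (\<Sum>b\<in>Basis. (w \<bullet> b) *\<^sub>R frechet_derivative h (at (f x)) b)" for w
      using arg_cong[OF euclidean_representation[of w, symmetric], of "frechet_derivative h (at (f x))"]
      by (simp add: h.sum h.scaleR)
    then have "?D x = (\<lambda>v. frechet_derivative h (at (f x)) (frechet_derivative f (at x) v))"
      by (metis (no_types, lifting) ext)
    then show ?thesis
      using has_derivative_compose[OF f h] by simp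
  qed
  moreover have "Ck_on k S (\<lambda>x. ?D x v)" for v
    using Suc.prems
    by (intro Ck_on_sum Ck_on_scaleR Ck_on_bounded_linear[OF bounded_linear_inner_left]
        assms(1) Suc.IH Ck_on_SucD[OF Suc.prems(1)]) auto
  ultimately show ?case
    by (rule Ck_on_SucI[OF assms(1)])
qed

text \<open>Openness of the pieces glues continuity, the base case; differentiability at a point is
  local already.\<close>

lemma Ck_on_UN:
  assumes "\<And>i. i \<in> I \<Longrightarrow> open (S i)" "\<And>i. i \<in> I \<Longrightarrow> Ck_on k (S i) f"
  shows "Ck_on k (\<Union>i\<in>I. S i) f"
  using assms(2)
proof (induction k arbitrary: f)
  case 0
  then show ?case
    using assms(1) by (auto intro: continuous_on_open_UN)
qed auto

lemma smooth_map_onD: "smooth_map_on S f \<Longrightarrow> x \<in> S \<Longrightarrow> f differentiable (at x)"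
  unfolding smooth_map_on_def by (metis Ck_on.simps(2))

lemma smooth_map_on_derivative:
  "smooth_map_on S f \<Longrightarrow> smooth_map_on S (\<lambda>x. frechet_derivative f (at x) v)"
  unfolding smooth_map_on_def by (metis Ck_on.simps(2))

lemma smooth_map_on_compose:
  fixes f :: "'a::real_normed_vector \<Rightarrow> 'b::euclidean_space"
  assumes "open S" "f ` S \<subseteq> T" "smooth_map_on S f" "smooth_map_on T h"
  shows "smooth_map_on S (\<lambda>x. h (f x))"
  using assms Ck_on_compose unfolding smooth_map_on_def by blast

lemma smooth_map_on_cong:
  "open S \<Longrightarrow> (\<And>x. x \<in> S \<Longrightarrow> f x = h x) \<Longrightarrow> smooth_map_on S f \<Longrightarrow> smooth_map_on S h"
  unfolding smooth_map_on_def using Ck_on_cong by metis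

lemma smooth_map_on_subset: "smooth_map_on T f \<Longrightarrow> S \<subseteq> T \<Longrightarrow> smooth_map_on S f"
  unfolding smooth_map_on_def using Ck_on_subset by metis

section \<open>Inner products on subspaces\<close>

lemma linear_on_subspaceD:
  assumes "linear_on_subspace V L" "subspace V"
  shows linear_on_add: "v \<in> V \<Longrightarrow> w \<in> V \<Longrightarrow> L (v + w) = L v + L w"
    and linear_on_scale: "v \<in> V \<Longrightarrow> L (c *\<^sub>R v) = c *\<^sub>R L v"
    and linear_on_zero: "L 0 = 0"
    and linear_on_diff: "v \<in> V \<Longrightarrow> w \<in> V \<Longrightarrow> L (v - w) = L v - L w"
    and linear_on_sum: "(\<And>i. i \<in> I \<Longrightarrow> f i \<in> V) \<Longrightarrow> L (\<Sum>i\<in>I. f i) = (\<Sum>i\<in>I. L (f i))"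
proof -
  have lin: "L (a *\<^sub>R v + b *\<^sub>R w) = a *\<^sub>R L v + b *\<^sub>R L w" if "v \<in> V" "w \<in> V" for a b v w
    using assms(1) that unfolding linear_on_subspace_def by blast
  show add: "L (v + w) = L v + L w" if "v \<in> V" "w \<in> V" for v w
    using lin[OF that, of 1 1] by simp
  show "L (c *\<^sub>R v) = c *\<^sub>R L v" if "v \<in> V" for v c
    using lin[OF that that, of c 0] by simp
  show zero: "L 0 = 0"
    using lin[OF subspace_0[OF assms(2)] subspace_0[OF assms(2)], of 0 0] by simp
  show "L (v - w) = L v - L w" if "v \<in> V" "w \<in> V" for v w
    using lin[OF that, of 1 "-1"] by simp
  show "L (\<Sum>i\<in>I. f i) = (\<Sum>i\<in>I. L (f i))" if "\<And>i. i \<in> I \<Longrightarrow> f i \<in> V" for I and f :: "'c \<Rightarrow> 'a"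
    using that
    by (induction I rule: infinite_finite_induct)
       (auto simp: zero add subspace_sum[OF assms(2)])
qed

text \<open>Tangent spaces are subsets of a function space and not types, so linearity, symmetry and
  positivity are asked on \<open>V\<close> alone.\<close>

locale inner_product_on =
  fixes V :: "'a::real_vector set" and G :: "'a \<Rightarrow> 'a \<Rightarrow> real"
  assumes sub: "subspace V"
    and lin: "v \<in> V \<Longrightarrow> linear_on_subspace V (G v)"
    and sym: "v \<in> V \<Longrightarrow> w \<in> V \<Longrightarrow> G v w = G w v"
    and pos: "v \<in> V \<Longrightarrow> v \<noteq> 0 \<Longrightarrow> G v v > 0"
begin

lemma lin_left: "w \<in> V \<Longrightarrow> linear_on_subspace V (\<lambda>v. G v w)"
  using lin sym sub unfolding linear_on_subspace_def
  by (smt (verit) subspace_add subspace_scale)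

lemmas right_simps = linear_on_add[OF lin sub] linear_on_scale[OF lin sub] linear_on_zero[OF lin sub]
  linear_on_diff[OF lin sub] linear_on_sum[OF lin sub]
lemmas left_simps = linear_on_add[OF lin_left sub] linear_on_scale[OF lin_left sub]
  linear_on_zero[OF lin_left sub] linear_on_diff[OF lin_left sub] linear_on_sum[OF lin_left sub]
lemmas closed = subspace_add[OF sub] subspace_scale[OF sub] subspace_diff[OF sub]
  subspace_sum[OF sub] subspace_0[OF sub]

text \<open>Members are nonzero but not normalised: this fits smooth frames, and orthonormal
  families are the case of unit vectors.\<close>

definition orthogonal_family :: "'i set \<Rightarrow> ('i \<Rightarrow> 'a) \<Rightarrow> bool" where
  "orthogonal_family I e \<longleftrightarrow> finite I \<and> (\<forall>i\<in>I. e i \<in> V \<and> e i \<noteq> 0) \<and>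
     (\<forall>i\<in>I. \<forall>j\<in>I. i \<noteq> j \<longrightarrow> G (e i) (e j) = 0)"

lemma span_family_subset: "orthogonal_family I e \<Longrightarrow> span (e ` I) \<subseteq> V"
  unfolding orthogonal_family_def by (intro span_minimal sub) auto

definition proj :: "'i set \<Rightarrow> ('i \<Rightarrow> 'a) \<Rightarrow> 'a \<Rightarrow> 'a" where
  "proj I e v = (\<Sum>i\<in>I. (G v (e i) / G (e i) (e i)) *\<^sub>R e i)"

lemma proj_in_span: "proj I e v \<in> span (e ` I)"
  unfolding proj_def by (intro span_sum span_scale span_base) auto

lemma residue_orthogonal:
  assumes "orthogonal_family I e" "v \<in> V" "j \<in> I"
  shows "G (v - proj I e v) (e j) = 0"
proof -
  have e: "e i \<in> V" "finite I" if "i \<in> I" for i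
    using assms(1) that unfolding orthogonal_family_def by auto
  have nz: "G (e j) (e j) \<noteq> 0"
    using assms(1,3) pos unfolding orthogonal_family_def by force
  have "G (proj I e v) (e j) = (\<Sum>i\<in>I. (G v (e i) / G (e i) (e i)) * G (e i) (e j))"
    unfolding proj_def using e assms(3) by (simp add: left_simps closed)
  \<comment> \<open>Only the term \<open>i = j\<close> survives, and there
    \<open>G (e j) (e j)\<close> cancels the denominator.\<close>
  also have "\<dots> = (\<Sum>i\<in>I. if i = j then G v (e i) else 0)"
    using assms nz unfolding orthogonal_family_def by (intro sum.cong) auto
  also have "\<dots> = G v (e j)"
    using e assms(3) by simp
  finally show ?thesis
    using assms e[OF assms(3)] span_family_subset[OF assms(1)] proj_in_span
    by (subst left_simps) auto
qed

lemma orthogonal_span: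
  assumes "u \<in> V" "S \<subseteq> V" "\<And>s. s \<in> S \<Longrightarrow> G u s = 0" "w \<in> span S"
  shows "G u w = 0"
proof -
  have "subspace {w \<in> V. G u w = 0}"
    using assms(1) by (intro subspaceI) (auto simp: right_simps closed)
  then have "span S \<subseteq> {w \<in> V. G u w = 0}"
    using assms(2,3) by (intro span_minimal) auto
  then show ?thesis using assms(4) by auto
qed

text \<open>The residue lies in the span and is orthogonal to it, hence to itself, so positivity
  makes it 0.\<close>

lemma proj_eq:
  assumes "orthogonal_family I e" "v \<in> span (e ` I)"
  shows "proj I e v = v"
proof -
  let ?r = "v - proj I e v"
  have v: "v \<in> V" using assms span_family_subset by blast
  have r: "?r \<in> span (e ` I)" using assms(2) proj_in_span span_diff by blast
  have rV: "?r \<in> V" using r assms span_family_subset by blast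
  have "G ?r ?r = 0"
    using assms residue_orthogonal[OF assms(1) v] rV r
    by (intro orthogonal_span[of ?r "e ` I" ?r]) (auto simp: orthogonal_family_def)
  then show ?thesis using pos[OF rV] by fastforce
qed

text \<open>One Gram-Schmidt step. The free factor \<open>c\<close> is taken to be 1 for smooth
  frames and the inverse length for orthonormal bases.\<close>

lemma orthogonal_family_insert:
  assumes "orthogonal_family I e" "v \<in> V" "v \<notin> span (e ` I)" "i \<notin> I" "c \<noteq> 0"
  shows "orthogonal_family (insert i I) (e(i := c *\<^sub>R (v - proj I e v)))"
proof -
  let ?r = "v - proj I e v"
  have "proj I e v \<in> V"
    using proj_in_span assms(1) span_family_subset by blast
  then have r: "?r \<in> V" using assms(2) closed by blast
  have "?r \<noteq> 0" using assms(3) proj_in_span by (metis eq_iff_diff_eq_0)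
  moreover have "G (c *\<^sub>R ?r) (e j) = 0" "G (e j) (c *\<^sub>R ?r) = 0" if "j \<in> I" for j
  proof -
    have e: "e j \<in> V" using that assms(1) by (auto simp: orthogonal_family_def)
    show *: "G (c *\<^sub>R ?r) (e j) = 0"
      using residue_orthogonal[OF assms(1,2) that] left_simps(2)[OF e r, of c] by simp
    show "G (e j) (c *\<^sub>R ?r) = 0"
      using * sym[OF e closed(2)[OF r]] by simp
  qed
  ultimately show ?thesis
    using assms(1,4,5) r unfolding orthogonal_family_def by (auto simp: closed)
qed

text \<open>A member in the span of the others would be orthogonal to itself, against
  positivity.\<close>

lemma orthogonal_family_independent:
  assumes "orthogonal_family I e"
  shows "independent (e ` I)" and "card (e ` I) = card I"
proof -
  have nz: "G (e i) (e i) \<noteq> 0" "e i \<in> V" if "i \<in> I" for i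
    using assms pos that unfolding orthogonal_family_def by force+
  have "inj_on e I"
    using assms nz unfolding orthogonal_family_def by (metis inj_onI)
  then show "card (e ` I) = card I" by (rule card_image)
  have False if "i \<in> I" "e i \<in> span (e ` I - {e i})" for i
  proof -
    have "G (e i) (e i) = 0"
    proof (rule orthogonal_span[OF nz(2)[OF that(1)] _ _ that(2)])
      show "e ` I - {e i} \<subseteq> V" using nz(2) by blast
      show "G (e i) s = 0" if s: "s \<in> e ` I - {e i}" for s
      proof -
        obtain j where "j \<in> I" "s = e j" "i \<noteq> j" using s by auto
        then show ?thesis using assms \<open>i \<in> I\<close> by (simp add: orthogonal_family_def)
      qed
    qed
    then show False using nz(1)[OF that(1)] by blast
  qed
  then show "independent (e ` I)"
    unfolding dependent_def by blast
qed

text \<open>Gram-Schmidt starting from \<open>u\<close>, with its length controlled by counting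
  against \<open>B\<close>: a family indexed by \<open>{..k}\<close> has \<open>k + 1\<close>
  members, so it cannot span before \<open>k = m\<close> and must span then.\<close>

lemma orthonormal_basis_exists:
  assumes "u \<in> V" "G u u = 1" "independent B" "card B = Suc m" "span B = V"
  shows "\<exists>e. e 0 = u \<and> (\<forall>i\<le>m. \<forall>j\<le>m. G (e i) (e j) = (if i = j then 1 else 0))
    \<and> span (e ` {..m}) = V"
proof -
  let ?P = "\<lambda>k e. orthogonal_family {..k} e \<and> (\<forall>i\<le>k. G (e i) (e i) = 1) \<and> e 0 = u"
  have finB: "finite B" using assms(4) card.infinite by fastforce
  have step: "\<exists>e. ?P (Suc k) e" if P: "?P k e" and ne: "span (e ` {..k}) \<noteq> V"
    for k and e :: "nat \<Rightarrow> 'a"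
  proof -
    obtain v where v: "v \<in> V" "v \<notin> span (e ` {..k})"
      using ne P span_family_subset by blast
    define r where "r = v - proj {..k} e v"
    have "proj {..k} e v \<in> V"
      using span_family_subset[of "{..k}" e] P proj_in_span by blast
    then have "r \<in> V" unfolding r_def by (rule closed(3)[OF v(1)])
    moreover have "r \<noteq> 0" unfolding r_def
      using v(2) proj_in_span by (metis eq_iff_diff_eq_0)
    ultimately have r: "r \<in> V" "G r r > 0" using pos by auto
    define c where "c = 1 / sqrt (G r r)"
    have c: "c \<noteq> 0" "c * (c * G r r) = 1"
      using r(2) by (auto simp: c_def field_simps)
    have "?P (Suc k) (e(Suc k := c *\<^sub>R r))"
      using orthogonal_family_insert[of "{..k}" e v "Suc k" c] P v c r
      by (auto simp: r_def[symmetric] atMost_Suc left_simps right_simps closed le_Suc_eq)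
    then show ?thesis by blast
  qed
  \<comment> \<open>The Steinitz bound is used in both directions: an orthogonal family has at most
    \<open>card B\<close> members, and a spanning one has at least as many.\<close>
  have card_le: "k \<le> m" if "?P k e" for k e
  proof -
    have "e ` {..k} \<subseteq> span B" using that assms(5) by (auto simp: orthogonal_family_def)
    then have "card (e ` {..k}) \<le> card B"
      using independent_span_bound[OF finB] orthogonal_family_independent[of "{..k}" e] that by blast
    then show ?thesis using orthogonal_family_independent(2)[of "{..k}" e] that assms(4) by simp
  qed
  have card_ge: "m \<le> k" if "span (e ` {..k}) = V" for k and e :: "nat \<Rightarrow> 'a"
  proof -
    have "card B \<le> card (e ` {..k})"
      using independent_span_bound[of "e ` {..k}" B] assms(3,5) that span_superset by force
    also have "\<dots> \<le> Suc k" using card_image_le[of "{..k}" e] by simp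
    finally show ?thesis using assms(4) by simp
  qed
  have ex: "\<exists>e. ?P k e" if "k \<le> m" for k
    using that
  proof (induction k)
    case 0
    have "u \<noteq> 0" using assms(1,2) right_simps(3) by force
    then show ?case
      using assms(1,2) by (intro exI[of _ "\<lambda>_. u"]) (auto simp: orthogonal_family_def)
  next
    case (Suc k)
    then obtain e where e: "?P k e" by auto
    then show ?case
      using step[OF e] card_ge[of e k] Suc.prems by fastforce
  qed
  obtain e where e: "?P m e" using ex by blast
  have "span (e ` {..m}) = V"
  proof (rule ccontr)
    assume "span (e ` {..m}) \<noteq> V"
    then obtain e' where "?P (Suc m) e'" using step[OF e] by blast
    then show False using card_le[of "Suc m" e'] by simp
  qed
  then show ?thesis
    using e by (intro exI[of _ e]) (auto simp: orthogonal_family_def)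
qed

text \<open>\<open>trace_on\<close> is computed in an arbitrarily chosen basis \<open>B\<close>.
  Expanding each \<open>b\<close> in the orthonormal family and each \<open>L (e i)\<close> in
  \<open>B\<close> turns one sum into the other after exchanging the order of summation.\<close>

lemma trace_on_orthonormal:
  assumes "linear_on_subspace V L" "L ` V \<subseteq> V"
    and "finite I" "\<And>i j. i \<in> I \<Longrightarrow> j \<in> I \<Longrightarrow> G (e i) (e j) = (if i = j then 1 else 0)"
    and "span (e ` I) = V"
  shows "trace_on V L = (\<Sum>i\<in>I. G (L (e i)) (e i))"
proof -
  have eV: "e i \<in> V" if "i \<in> I" for i
    using span_base[OF imageI[OF that], of e] unfolding assms(5) .
  have "e i \<noteq> 0" if "i \<in> I" for i
    using assms(4)[OF that that] right_simps(3)[OF eV[OF that]] by auto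
  then have orth: "orthogonal_family I e"
    using assms(3,4) eV unfolding orthogonal_family_def by auto
  \<comment> \<open>The choice succeeds because the orthonormal family is itself a basis of
    \<open>V\<close>.\<close>
  define B where "B = (SOME B. independent B \<and> span B = V)"
  have B: "independent B" "span B = V"
    using orthogonal_family_independent(1)[OF orth] assms(5)
      someI[of "\<lambda>B. independent B \<and> span B = V" "e ` I"] unfolding B_def by auto
  have fin: "finite B"
    using independent_span_bound[OF finite_imageI[OF assms(3)] B(1)] B(2) assms(5) span_superset[of B]
    by blast
  have BV: "b \<in> V" if "b \<in> B" for b
    using span_base[OF that] unfolding B(2) .
  have LV: "L v \<in> V" if "v \<in> V" for v using assms(2) that by blast
  have expand: "v = (\<Sum>i\<in>I. G v (e i) *\<^sub>R e i)" if "v \<in> V" for v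
    using proj_eq[OF orth, of v] assms(4,5) that unfolding proj_def by simp
  have rep: "v = (\<Sum>b\<in>B. representation B v b *\<^sub>R b)" if "v \<in> V" for v
    using real_vector.sum_representation_eq[OF B(1) _ fin, of v] that B(2) by simp
  have replin: "representation B (\<Sum>i\<in>I. c i *\<^sub>R w i) b = (\<Sum>i\<in>I. c i * representation B (w i) b)"
    if "\<And>i. i \<in> I \<Longrightarrow> w i \<in> V" for c w b
    using that B closed
    by (subst real_vector.representation_sum) (auto simp: real_vector.representation_scale)
  have "trace_on V L = (\<Sum>b\<in>B. representation B (L b) b)"
    unfolding trace_on_def B_def Let_def ..
  also have "\<dots> = (\<Sum>b\<in>B. \<Sum>i\<in>I. G b (e i) * representation B (L (e i)) b)"
  proof (rule sum.cong)
    fix b assume b: "b \<in> B"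
    have "L b = L (\<Sum>i\<in>I. G b (e i) *\<^sub>R e i)"
      using arg_cong[of b "\<Sum>i\<in>I. G b (e i) *\<^sub>R e i" L] expand[OF BV[OF b]] by blast
    also have "\<dots> = (\<Sum>i\<in>I. L (G b (e i) *\<^sub>R e i))"
      using eV closed(2) by (intro linear_on_sum[OF assms(1) sub]) blast
    also have "\<dots> = (\<Sum>i\<in>I. G b (e i) *\<^sub>R L (e i))"
      using eV by (intro sum.cong linear_on_scale[OF assms(1) sub]) blast+
    finally show "representation B (L b) b = (\<Sum>i\<in>I. G b (e i) * representation B (L (e i)) b)"
      by (simp only: replin[OF LV[OF eV]])
  qed simp
  also have "\<dots> = (\<Sum>i\<in>I. \<Sum>b\<in>B. representation B (L (e i)) b * G b (e i))"
    by (subst sum.swap) (simp add: mult.commute)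
  also have "\<dots> = (\<Sum>i\<in>I. G (L (e i)) (e i))"
  proof (rule sum.cong)
    fix i assume i: "i \<in> I"
    have "G (L (e i)) (e i) = G (\<Sum>b\<in>B. representation B (L (e i)) b *\<^sub>R b) (e i)"
      using rep[OF LV[OF eV[OF i]], symmetric] by simp
    also have "\<dots> = (\<Sum>b\<in>B. representation B (L (e i)) b * G b (e i))"
      using BV eV[OF i] by (simp add: left_simps closed)
    finally show "(\<Sum>b\<in>B. representation B (L (e i)) b * G b (e i)) = G (L (e i)) (e i)" by simp
  qed simp
  finally show ?thesis .
qed

text \<open>Existence comes from expanding \<open>w\<close> in the orthogonal family, uniqueness
  from positivity applied to the difference of two representing vectors. The explicit
  \<open>u\<close> is what later shows the gradient to be smooth.\<close>

lemma riesz: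
  assumes "orthogonal_family I e" "span (e ` I) = V" "linear_on_subspace V l"
  defines "u \<equiv> \<Sum>i\<in>I. (l (e i) / G (e i) (e i)) *\<^sub>R e i"
  shows "(THE v. v \<in> V \<and> (\<forall>w\<in>V. G v w = l w)) = u"
    and "u \<in> V" and "w \<in> V \<Longrightarrow> G u w = l w"
proof -
  have eV: "e i \<in> V" if "i \<in> I" for i using assms(1) that by (auto simp: orthogonal_family_def)
  show uV: "u \<in> V" unfolding u_def using eV by (auto intro!: closed)
  show ul: "G u w = l w" if "w \<in> V" for w
  proof -
    have "l w = l (proj I e w)" using proj_eq[OF assms(1)] assms(2) that by simp
    also have "\<dots> = (\<Sum>i\<in>I. G w (e i) / G (e i) (e i) * l (e i))"
      unfolding proj_def using eV closed
      by (simp add: linear_on_sum[OF assms(3) sub] linear_on_scale[OF assms(3) sub])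
    also have "\<dots> = (\<Sum>i\<in>I. l (e i) / G (e i) (e i) * G (e i) w)"
      using eV that sym by (intro sum.cong) (auto simp: sym)
    also have "\<dots> = G u w"
      unfolding u_def using eV that by (simp add: left_simps closed)
    finally show ?thesis by simp
  qed
  show "(THE v. v \<in> V \<and> (\<forall>w\<in>V. G v w = l w)) = u"
  proof (rule the_equality)
    show "u \<in> V \<and> (\<forall>w\<in>V. G u w = l w)" using uV ul by blast
    fix v assume v: "v \<in> V \<and> (\<forall>w\<in>V. G v w = l w)"
    then have "G (v - u) (v - u) = 0"
      using uV ul closed by (simp add: left_simps)
    then show "v = u" using pos[of "v - u"] v uV closed by fastforce
  qed
qed

end

section \<open>Smooth functions and tangent vectors in charts\<close>

lemma sum_fun_apply: "(\<Sum>i\<in>I. f i) x = (\<Sum>i\<in>I. f i x)"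
  by (induction I rule: infinite_finite_induct) auto

lemma scaleR_fun_apply: "(c *\<^sub>R f) x = c *\<^sub>R f x"
  by (simp add: scaleR_fun_def)

context smooth_manifold
begin

section \<open>Charts and smooth functions on open sets\<close>

lemma chart_open: "(U, \<psi>) \<in> A \<Longrightarrow> open U"
  using chart by blast

lemma chart_image_open:
  assumes "(U, \<psi>) \<in> A" "open W"
  shows "open (\<psi> ` (U \<inter> W))"
proof -
  have "openin (top_of_set (\<psi> ` U)) (\<psi> ` (U \<inter> W))"
    using chart[OF assms(1)] assms(2)
    by (intro homeomorphism_imp_open_map[of U _ \<psi> "inv_into U \<psi>"]) auto
  then show ?thesis
    using chart[OF assms(1)] by (auto simp: openin_open_eq)
qed

lemma chart_inv: "(U, \<psi>) \<in> A \<Longrightarrow> p \<in> U \<Longrightarrow> inv_into U \<psi> (\<psi> p) = p"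
  using chart unfolding homeomorphism_def by blast

lemma chart_inv_mem: "y \<in> \<psi> ` U \<Longrightarrow> inv_into U \<psi> y \<in> U"
  by (rule inv_into_into)

lemma chart_inv_right: "y \<in> \<psi> ` U \<Longrightarrow> \<psi> (inv_into U \<psi> y) = y"
  by (rule f_inv_into_f)

lemma exists_chart: "\<exists>U \<psi>. (U, \<psi>) \<in> A \<and> p \<in> U"
proof -
  have "p \<in> (\<Union>(U, \<psi>)\<in>A. U)" unfolding covering by simp
  then show ?thesis by auto
qed

lemma smooth_fun_onI:
  "(\<And>U \<psi>. (U, \<psi>) \<in> A \<Longrightarrow> smooth_map_on (\<psi> ` (U \<inter> V)) (\<lambda>y. f (inv_into U \<psi> y))) \<Longrightarrow>
    smooth_fun_on A V f"
  unfolding smooth_fun_on_def by (auto simp: comp_def)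

lemma smooth_fun_onD:
  "smooth_fun_on A V f \<Longrightarrow> (U, \<psi>) \<in> A \<Longrightarrow> smooth_map_on (\<psi> ` (U \<inter> V)) (\<lambda>y. f (inv_into U \<psi> y))"
  unfolding smooth_fun_on_def by (auto simp: comp_def)

lemma smooth_fun_on_subset: "smooth_fun_on A V f \<Longrightarrow> W \<subseteq> V \<Longrightarrow> smooth_fun_on A W f"
  by (rule smooth_fun_onI, rule smooth_map_on_subset[OF smooth_fun_onD]) auto

lemma smooth_fun_on_cong:
  assumes "open V" "smooth_fun_on A V f" "\<And>q. q \<in> V \<Longrightarrow> f q = h q"
  shows "smooth_fun_on A V h"
  using assms(3)
  by (intro smooth_fun_onI smooth_map_on_cong[OF chart_image_open[OF _ assms(1)] _ smooth_fun_onD[OF assms(2)]])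
     (auto simp: chart_inv)

lemma smooth_fun_on_const: "open V \<Longrightarrow> smooth_fun_on A V (\<lambda>_. c)"
  by (rule smooth_fun_onI) (auto simp: smooth_map_on_def intro!: Ck_on_const chart_image_open)

lemma smooth_fun_on_add:
  assumes "open V" "smooth_fun_on A V f" "smooth_fun_on A V h"
  shows "smooth_fun_on A V (\<lambda>q. f q + h q)"
  using smooth_fun_onD[OF assms(2)] smooth_fun_onD[OF assms(3)] chart_image_open[OF _ assms(1)]
  by (intro smooth_fun_onI) (simp add: smooth_map_on_def Ck_on_add)

lemma smooth_fun_on_mult:
  assumes "open V" "smooth_fun_on A V f" "smooth_fun_on A V h"
  shows "smooth_fun_on A V (\<lambda>q. f q * h q)"
  using smooth_fun_onD[OF assms(2)] smooth_fun_onD[OF assms(3)] chart_image_open[OF _ assms(1)]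
  by (intro smooth_fun_onI) (simp add: smooth_map_on_def Ck_on_mult)

lemma smooth_fun_on_divide:
  assumes "open V" "smooth_fun_on A V f" "smooth_fun_on A V h" "\<And>q. q \<in> V \<Longrightarrow> h q \<noteq> 0"
  shows "smooth_fun_on A V (\<lambda>q. f q / h q)"
proof -
  have "smooth_fun_on A V (\<lambda>q. inverse (h q))"
    using smooth_fun_onD[OF assms(3)] chart_image_open[OF _ assms(1)] assms(4)
    unfolding smooth_map_on_def
    by (intro smooth_fun_onI) (auto simp: smooth_map_on_def chart_inv intro!: Ck_on_inverse)
  from smooth_fun_on_mult[OF assms(1,2) this] show ?thesis
    by (simp add: divide_inverse)
qed

lemma smooth_fun_on_sum:
  assumes "open V" "\<And>i. i \<in> I \<Longrightarrow> smooth_fun_on A V (f i)"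
  shows "smooth_fun_on A V (\<lambda>q. \<Sum>i\<in>I. f i q)"
  using assms(2)
  by (induction I rule: infinite_finite_induct)
     (auto intro!: smooth_fun_on_add smooth_fun_on_const assms(1))

text \<open>In every chart the pieces have open images, so \<open>Ck_on_UN\<close> glues them. This
  serves the gradient, whose frame formula holds only over chart domains.\<close>

lemma smooth_fun_on_local:
  assumes "\<And>p. p \<in> V \<Longrightarrow> \<exists>W. open W \<and> p \<in> W \<and> smooth_fun_on A W f"
  shows "smooth_fun_on A V f"
proof (rule smooth_fun_onI)
  fix U \<psi> assume U: "(U, \<psi>) \<in> A"
  obtain W where W: "\<And>p. p \<in> V \<Longrightarrow> open (W p) \<and> p \<in> W p \<and> smooth_fun_on A (W p) f"
    using assms by metis
  have "Ck_on k (\<Union>p\<in>V. \<psi> ` (U \<inter> W p)) (\<lambda>y. f (inv_into U \<psi> y))" for k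
    using W smooth_fun_onD[OF _ U] chart_image_open[OF U]
    by (intro Ck_on_UN) (auto simp: smooth_map_on_def)
  then show "smooth_map_on (\<psi> ` (U \<inter> V)) (\<lambda>y. f (inv_into U \<psi> y))"
    unfolding smooth_map_on_def using W by (blast intro: Ck_on_subset)
qed

text \<open>In another chart the function reads as \<open>F\<close> after a transition map, which is
  smooth by \<open>compatible\<close>.\<close>

lemma smooth_fun_on_chart:
  assumes "(U, \<psi>) \<in> A" "open V" "V \<subseteq> U" "smooth_map_on (\<psi> ` V) F"
  shows "smooth_fun_on A V (\<lambda>q. F (\<psi> q))"
proof (rule smooth_fun_onI)
  fix W \<theta> assume W: "(W, \<theta>) \<in> A"
  have "smooth_map_on (\<theta> ` (W \<inter> V)) (\<lambda>y. \<psi> (inv_into W \<theta> y))"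
    using compatible[OF W assms(1)] assms(3)
    by (auto simp: comp_def intro: smooth_map_on_subset)
  moreover have "(\<lambda>y. \<psi> (inv_into W \<theta> y)) ` (\<theta> ` (W \<inter> V)) \<subseteq> \<psi> ` V"
    using chart_inv[OF W] by auto
  ultimately show "smooth_map_on (\<theta> ` (W \<inter> V)) (\<lambda>y. F (\<psi> (inv_into W \<theta> y)))"
    using smooth_map_on_compose[OF chart_image_open[OF W assms(2)] _ _ assms(4)] by blast
qed

text \<open>The tangent vector at \<open>p\<close> with coordinates \<open>v\<close>. The value 0 on
  functions not smooth near \<open>p\<close> matches the default in \<open>velocity\<close>, so that
  the two can be equal as functionals.\<close>

definition chart_vector :: "'m set \<Rightarrow> ('m \<Rightarrow> 'e) \<Rightarrow> 'e \<Rightarrow> 'm \<Rightarrow> 'm tvec" where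
  "chart_vector U \<psi> v p = (\<lambda>f. if smooth_near A p f
     then frechet_derivative (\<lambda>y. f (inv_into U \<psi> y)) (at (\<psi> p)) v else 0)"

lemma smooth_near_differentiable:
  assumes "(U, \<psi>) \<in> A" "p \<in> U" "smooth_near A p f"
  shows "(\<lambda>y. f (inv_into U \<psi> y)) differentiable (at (\<psi> p))"
  using assms smooth_fun_onD[OF _ assms(1)] unfolding smooth_near_def
  by (meson IntI imageI smooth_map_onD)

lemma linear_chart_vector:
  assumes "(U, \<psi>) \<in> A" "p \<in> U"
  shows "linear (\<lambda>v. chart_vector U \<psi> v p)"
proof -
  have "linear (frechet_derivative (\<lambda>y. f (inv_into U \<psi> y)) (at (\<psi> p)))" if "smooth_near A p f" for f
    using smooth_near_differentiable[OF assms that] linear_frechet_derivative by blast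
  then show ?thesis
    by (intro linearI)
       (auto simp: chart_vector_def fun_eq_iff scaleR_fun_apply linear_add linear_scale)
qed

text \<open>Chain rule for \<open>f \<circ> \<gamma>\<close>, read as the coordinate form of
  \<open>f\<close> after the coordinate form of the curve.\<close>

lemma velocity_eq_chart_vector:
  assumes "(U, \<psi>) \<in> A" "p \<in> U" "\<gamma> 0 = p" "\<epsilon> > 0" "smooth_curve A \<epsilon> \<gamma>"
  shows "velocity A \<gamma> = chart_vector U \<psi> (frechet_derivative (\<lambda>t. \<psi> (\<gamma> t)) (at 0) 1) p"
proof
  fix f :: "'m \<Rightarrow> real"
  let ?c = "\<lambda>t. \<psi> (\<gamma> t)" and ?F = "\<lambda>y. f (inv_into U \<psi> y)"
  show "velocity A \<gamma> f = chart_vector U \<psi> (frechet_derivative ?c (at 0) 1) p f"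
  proof (cases "smooth_near A p f")
    case True
    let ?S = "{-\<epsilon><..<\<epsilon>} \<inter> \<gamma> -` U"
    have "smooth_map_on ?S ?c"
      using assms(1,5) unfolding smooth_curve_def comp_def by blast
    then have "?c differentiable (at 0)"
      using assms(2-4) by (intro smooth_map_onD) auto
    then have c: "(?c has_derivative frechet_derivative ?c (at 0)) (at 0)"
      by (simp add: frechet_derivative_works)
    have F: "(?F has_derivative frechet_derivative ?F (at (?c 0))) (at (?c 0))"
      using smooth_near_differentiable[OF assms(1,2) True] assms(3) by (simp add: frechet_derivative_works)
    let ?L = "\<lambda>h. frechet_derivative ?F (at (?c 0)) (frechet_derivative ?c (at 0) h)"
    have D: "((\<lambda>t. ?F (?c t)) has_derivative ?L) (at 0)"
      using has_derivative_compose[OF c F] .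
    \<comment> \<open>On this open set the curve stays in \<open>U\<close>, so passing through the
      chart and back changes nothing near 0.\<close>
    have "open ?S"
      using assms(5) chart_open[OF assms(1)] unfolding smooth_curve_def
      by (intro continuous_open_preimage) auto
    then have "(f \<circ> \<gamma> has_derivative ?L) (at 0)"
      by (rule has_derivative_transform_within_open[OF D])
         (use assms(2-4) chart_inv[OF assms(1)] in auto)
    moreover from this have lin: "linear ?L"
      by (rule has_derivative_linear)
    \<comment> \<open>A linear map on the reals is multiplication by its value at 1; this passes
      from the Frechet derivative to \<open>deriv\<close>.\<close>
    have "?L = (*) (?L 1)"
    proof
      fix h :: real
      show "?L h = ?L 1 * h" using linear_scale[OF lin, of h 1] by (simp add: mult.commute[of h])
    qed
    ultimately have "deriv (f \<circ> \<gamma>) 0 = ?L 1"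
      by (intro DERIV_imp_deriv) (simp only: has_field_derivative_def)
    then show ?thesis
      using True assms(3) by (simp add: velocity_def chart_vector_def)
  qed (simp add: velocity_def chart_vector_def assms(3))
qed

lemma chart_vector_tangent:
  assumes U: "(U, \<psi>) \<in> A" and p: "p \<in> U"
  shows "chart_vector U \<psi> v p \<in> tangent_space A p"
proof -
  let ?l = "\<lambda>t::real. \<psi> p + t *\<^sub>R v"
  \<comment> \<open>The curve is the straight line through \<open>\<psi> p\<close> in direction
    \<open>v\<close>, pulled back by the chart.\<close>
  define \<gamma> where "\<gamma> = (\<lambda>t. inv_into U \<psi> (?l t))"
  have "open (?l -` (\<psi> ` U))"
    using chart[OF U] by (intro open_vimage continuous_intros) auto
  moreover have "0 \<in> ?l -` (\<psi> ` U)" using p by simp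
  \<comment> \<open>\<open>\<epsilon>\<close> keeps the line inside the image of the chart, where
    \<open>inv_into\<close> really inverts it.\<close>
  ultimately obtain \<epsilon> where \<epsilon>: "\<epsilon> > 0" "ball 0 \<epsilon> \<subseteq> ?l -` (\<psi> ` U)"
    using open_contains_ball by blast
  have l: "?l t \<in> \<psi> ` U" if "t \<in> {-\<epsilon><..<\<epsilon>}" for t
    using \<epsilon>(2) that by (auto simp: subset_iff dist_real_def)
  have \<gamma>0: "\<gamma> 0 = p" using chart_inv[OF U p] by (simp add: \<gamma>_def)
  have "continuous_on (\<psi> ` U) (inv_into U \<psi>)"
    using chart[OF U] unfolding homeomorphism_def by blast
  then have cont: "continuous_on {-\<epsilon><..<\<epsilon>} \<gamma>"
    unfolding \<gamma>_def
  proof (rule continuous_on_compose2)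
    show "continuous_on {-\<epsilon><..<\<epsilon>} ?l" by (intro continuous_intros)
  qed (use l in blast)
  have sm: "smooth_map_on S ?l" if "open S" for S
    unfolding smooth_map_on_def
    using that by (intro allI Ck_on_add Ck_on_const Ck_on_scaleR Ck_on_ident)
  have "smooth_map_on ({-\<epsilon><..<\<epsilon>} \<inter> \<gamma> -` W) (\<theta> \<circ> \<gamma>)" if W: "(W, \<theta>) \<in> A" for W \<theta>
  proof -
    let ?S = "{-\<epsilon><..<\<epsilon>} \<inter> \<gamma> -` W"
    have o: "open ?S"
      using cont chart_open[OF W] by (intro continuous_open_preimage) auto
    have "?l ` ?S \<subseteq> \<psi> ` (U \<inter> W)"
    proof
      fix y assume "y \<in> ?l ` ?S"
      then obtain t where t: "t \<in> {-\<epsilon><..<\<epsilon>}" "\<gamma> t \<in> W" "y = ?l t" by auto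
      then have "\<gamma> t \<in> U \<inter> W" "\<psi> (\<gamma> t) = y"
        using chart_inv_mem[OF l[OF t(1)]] chart_inv_right[OF l[OF t(1)]] t(2,3)
        by (simp_all add: \<gamma>_def)
      then show "y \<in> \<psi> ` (U \<inter> W)" by blast
    qed
    \<comment> \<open>In the chart \<open>\<theta>\<close> the curve is a transition map after the
      line, and both are smooth.\<close>
    from smooth_map_on_compose[OF o this sm[OF o] compatible[OF U W]]
    show ?thesis by (simp add: comp_def \<gamma>_def)
  qed
  then have curve: "smooth_curve A \<epsilon> \<gamma>"
    using cont unfolding smooth_curve_def by blast
  have "((\<lambda>t. \<psi> (\<gamma> t)) has_derivative (\<lambda>t. t *\<^sub>R v)) (at 0)"
  proof (rule has_derivative_transform_within_open[where f = ?l and s = "{-\<epsilon><..<\<epsilon>}"])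
    show "(?l has_derivative (\<lambda>t. t *\<^sub>R v)) (at 0)"
      by (auto intro!: derivative_eq_intros)
    show "?l t = \<psi> (\<gamma> t)" if "t \<in> {-\<epsilon><..<\<epsilon>}" for t
      using chart_inv_right[OF l[OF that]] by (simp add: \<gamma>_def)
  qed (use \<epsilon>(1) in auto)
  then have "frechet_derivative (\<lambda>t. \<psi> (\<gamma> t)) (at 0) = (\<lambda>t. t *\<^sub>R v)"
    by (rule frechet_derivative_at[symmetric])
  then have "velocity A \<gamma> = chart_vector U \<psi> v p"
    using velocity_eq_chart_vector[OF U p \<gamma>0 \<epsilon>(1) curve] by simp
  then show ?thesis
    using \<gamma>0 curve \<epsilon>(1) unfolding tangent_space_def mem_Collect_eq by metis
qed

lemma tangent_space_eq:
  assumes "(U, \<psi>) \<in> A" "p \<in> U"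
  shows "tangent_space A p = range (\<lambda>v. chart_vector U \<psi> v p)"
  using chart_vector_tangent[OF assms] velocity_eq_chart_vector[OF assms]
  unfolding tangent_space_def by fast

text \<open>Sums of velocities are not visibly velocities; in a chart, however, the set is the image
  of the model space under a linear map.\<close>

lemma subspace_tangent_space: "subspace (tangent_space A p)"
  using exists_chart[of p] tangent_space_eq linear_chart_vector subspace_UNIV linear_subspace_image
  by metis

text \<open>The components of \<open>v\<close> are recovered by applying the tangent vector to the
  coordinate functions of the chart.\<close>

lemma inj_chart_vector:
  assumes U: "(U, \<psi>) \<in> A" and p: "p \<in> U"
  shows "inj (\<lambda>v. chart_vector U \<psi> v p)"
proof (rule injI)
  fix v w assume eq: "chart_vector U \<psi> v p = chart_vector U \<psi> w p"
  have "u \<bullet> b = chart_vector U \<psi> u p (\<lambda>q. \<psi> q \<bullet> b)" for u b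
  proof -
    \<comment> \<open>Smoothness of the coordinate function puts it in the nonzero branch of
      \<open>chart_vector\<close>.\<close>
    have "smooth_map_on (\<psi> ` U) (\<lambda>y. y \<bullet> b)"
      unfolding smooth_map_on_def using chart[OF U]
      by (auto intro!: Ck_on_bounded_linear[OF bounded_linear_inner_left] Ck_on_ident)
    then have "smooth_near A p (\<lambda>q. \<psi> q \<bullet> b)"
      using smooth_fun_on_chart[OF U chart_open[OF U] order_refl] p chart_open[OF U]
      unfolding smooth_near_def by blast
    moreover have "((\<lambda>y. \<psi> (inv_into U \<psi> y) \<bullet> b) has_derivative (\<lambda>u. u \<bullet> b)) (at (\<psi> p))"
    proof (rule has_derivative_transform_within_open[of "\<lambda>y. y \<bullet> b"])
      show "((\<lambda>y. y \<bullet> b) has_derivative (\<lambda>u. u \<bullet> b)) (at (\<psi> p))"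
        by (auto intro!: derivative_eq_intros)
      show "open (\<psi> ` U)" using chart[OF U] by blast
    qed (use p in \<open>auto simp: chart_inv_right\<close>)
    then have "frechet_derivative (\<lambda>y. \<psi> (inv_into U \<psi> y) \<bullet> b) (at (\<psi> p)) = (\<lambda>u. u \<bullet> b)"
      by (rule frechet_derivative_at[symmetric])
    ultimately show ?thesis
      by (simp add: chart_vector_def)
  qed
  then show "v = w"
    using eq by (metis euclidean_eqI)
qed

text \<open>In coordinates the field acts on a function as its directional derivative along the
  constant \<open>v\<close>, which is smooth again.\<close>

lemma vector_field_chart_vector:
  assumes U: "(U, \<psi>) \<in> A"
  shows "vector_field_on A U (chart_vector U \<psi> v)"
  unfolding vector_field_on_def
proof (intro conjI ballI allI impI)
  fix V f assume V: "open V \<and> V \<subseteq> U \<and> smooth_fun_on A V f"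
  let ?F = "\<lambda>y. f (inv_into U \<psi> y)"
  have "\<psi> ` (U \<inter> V) = \<psi> ` V" using V by (simp add: Int_absorb1)
  then have "smooth_map_on (\<psi> ` V) (\<lambda>y. frechet_derivative ?F (at y) v)"
    using smooth_map_on_derivative[OF smooth_fun_onD[OF _ U, of V f]] V by simp
  then have "smooth_fun_on A V (\<lambda>p. frechet_derivative ?F (at (\<psi> p)) v)"
    using smooth_fun_on_chart[OF U] V by blast
  then show "smooth_fun_on A V (\<lambda>p. chart_vector U \<psi> v p f)"
    using V by (elim smooth_fun_on_cong[rotated]) (auto simp: chart_vector_def smooth_near_def)
qed (rule chart_vector_tangent[OF U])

section \<open>Pointwise operations on vector fields\<close>

lemma vector_field_onI:
  assumes "\<And>p. p \<in> U \<Longrightarrow> X p \<in> tangent_space A p"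
    and "\<And>V f. open V \<Longrightarrow> V \<subseteq> U \<Longrightarrow> smooth_fun_on A V f \<Longrightarrow> smooth_fun_on A V (\<lambda>p. X p f)"
  shows "vector_field_on A U X"
  unfolding vector_field_on_def by (simp add: assms)

lemma vector_field_onD:
  assumes "vector_field_on A U X"
  shows "p \<in> U \<Longrightarrow> X p \<in> tangent_space A p"
    and "open V \<Longrightarrow> V \<subseteq> U \<Longrightarrow> smooth_fun_on A V f \<Longrightarrow> smooth_fun_on A V (\<lambda>p. X p f)"
  using assms unfolding vector_field_on_def by simp_all

lemma vector_field_on_subset:
  assumes "vector_field_on A U X" "V \<subseteq> U"
  shows "vector_field_on A V X"
proof (rule vector_field_onI)
  show "X p \<in> tangent_space A p" if "p \<in> V" for p
    using vector_field_onD(1)[OF assms(1)] assms(2) that by blast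
  show "smooth_fun_on A W (\<lambda>p. X p f)" if "open W" "W \<subseteq> V" "smooth_fun_on A W f" for W f
    using vector_field_onD(2)[OF assms(1) that(1) _ that(3)] assms(2) that(2) by blast
qed

lemma vector_field_on_add:
  assumes "vector_field_on A U X" "vector_field_on A U Y"
  shows "vector_field_on A U (\<lambda>p. X p + Y p)"
  by (rule vector_field_onI)
     (simp_all add: vector_field_onD[OF assms(1)] vector_field_onD[OF assms(2)]
       subspace_add[OF subspace_tangent_space] smooth_fun_on_add)

lemma vector_field_on_scale:
  assumes "vector_field_on A U X" "smooth_fun_on A U f"
  shows "vector_field_on A U (\<lambda>p. f p *\<^sub>R X p)"
  by (rule vector_field_onI)
     (simp_all add: vector_field_onD[OF assms(1)] smooth_fun_on_subset[OF assms(2)]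
       subspace_scale[OF subspace_tangent_space] smooth_fun_on_mult scaleR_fun_apply)

lemma vector_field_on_zero: "vector_field_on A U (\<lambda>p. 0)"
  by (rule vector_field_onI)
     (simp_all add: smooth_fun_on_const subspace_0[OF subspace_tangent_space])

lemma vector_field_on_sum:
  assumes "\<And>i. i \<in> I \<Longrightarrow> vector_field_on A U (X i)"
  shows "vector_field_on A U (\<lambda>p. \<Sum>i\<in>I. X i p)"
  using assms
  by (induction I rule: infinite_finite_induct) (auto intro!: vector_field_on_add vector_field_on_zero)

end

section \<open>Orthogonal frames and the gradient\<close>

locale riemannian_manifold = smooth_manifold A
  for A :: "('m::{t2_space, second_countable_topology}, 'e::euclidean_space) chart set" +
  fixes g :: "'m \<Rightarrow> 'm tvec \<Rightarrow> 'm tvec \<Rightarrow> real"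
  assumes riemannian: "riemannian_metric A g"
begin

sublocale tan: inner_product_on "tangent_space A p" "g p" for p
  using riemannian subspace_tangent_space unfolding riemannian_metric_def
  by (unfold_locales) simp_all

lemma smooth_fun_on_metric:
  "open U \<Longrightarrow> vector_field_on A U X \<Longrightarrow> vector_field_on A U Y \<Longrightarrow>
    smooth_fun_on A U (\<lambda>p. g p (X p) (Y p))"
  using riemannian unfolding riemannian_metric_def by simp

text \<open>Linearity and injectivity of \<open>chart_vector\<close> transport the independence of
  \<open>Basis\<close> to the coordinate vectors.\<close>

lemma chart_vector_notin_span:
  assumes "(U, \<psi>) \<in> A" "p \<in> U" "b \<in> Basis" "B \<subseteq> Basis" "b \<notin> B"
  shows "chart_vector U \<psi> b p \<notin> span ((\<lambda>c. chart_vector U \<psi> c p) ` B)"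
proof
  let ?L = "\<lambda>v. chart_vector U \<psi> v p"
  assume "?L b \<in> span (?L ` B)"
  then have "?L b \<in> ?L ` span B"
    by (simp only: linear_span_image[OF linear_chart_vector[OF assms(1,2)]])
  then have "b \<in> span B"
    using injD[OF inj_chart_vector[OF assms(1,2)]] by blast
  moreover have "span B \<subseteq> span (Basis - {b})"
    using assms(4,5) by (intro span_mono) auto
  ultimately show False
    using independent_Basis assms(3) unfolding dependent_def by blast
qed

text \<open>Gram-Schmidt without normalisation, so that no square roots of smooth functions occur.\<close>

lemma orthogonal_frame_aux:
  assumes U: "(U, \<psi>) \<in> A" and B: "B \<subseteq> Basis"
  shows "\<exists>Y :: 'e \<Rightarrow> 'm vfield. (\<forall>b\<in>B. vector_field_on A U (Y b)) \<and>
    (\<forall>p\<in>U. tan.orthogonal_family p B (\<lambda>b. Y b p) \<and>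
      span ((\<lambda>b. Y b p) ` B) = span ((\<lambda>b. chart_vector U \<psi> b p) ` B))"
  using finite_subset[OF B finite_Basis] B
proof (induction B rule: finite_induct)
  case empty
  show ?case
    by (intro exI[of _ undefined]) (simp add: tan.orthogonal_family_def)
next
  case (insert b B)
  let ?E = "chart_vector U \<psi>"
  have b: "b \<in> Basis" "B \<subseteq> Basis" using insert.prems by auto
  from insert.IH[OF b(2)] obtain Y :: "'e \<Rightarrow> 'm vfield"
    where vf: "\<And>c. c \<in> B \<Longrightarrow> vector_field_on A U (Y c)"
      and orth: "\<And>p. p \<in> U \<Longrightarrow> tan.orthogonal_family p B (\<lambda>c. Y c p)"
      and sp: "\<And>p. p \<in> U \<Longrightarrow> span ((\<lambda>c. Y c p) ` B) = span ((\<lambda>c. ?E c p) ` B)"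
    by blast
  let ?P = "\<lambda>p. tan.proj p B (\<lambda>c. Y c p) (?E b p)"
  define Z where "Z = Y(b := \<lambda>p. ?E b p - ?P p)"
  \<comment> \<open>The factor 1 brings the new field into the form of
    \<open>orthogonal_family_insert\<close>.\<close>
  have Z: "(\<lambda>c. Z c p) = (\<lambda>c. Y c p)(b := 1 *\<^sub>R (?E b p - ?P p))" for p
    by (auto simp: Z_def)
  have ZB: "(\<lambda>c. Z c p) ` B = (\<lambda>c. Y c p) ` B" for p
    using insert.hyps(2) by (auto simp: Z_def)
  have vE: "vector_field_on A U (?E b)" by (rule vector_field_chart_vector[OF U])
  \<comment> \<open>Frame vectors are nonzero on \<open>U\<close>, so the denominators do not vanish
    and the projection coefficients are smooth.\<close>
  have "smooth_fun_on A U (\<lambda>p. g p (?E b p) (Y c p) / g p (Y c p) (Y c p))" if c: "c \<in> B" for c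
  proof (rule smooth_fun_on_divide[OF chart_open[OF U]])
    show "g p (Y c p) (Y c p) \<noteq> 0" if "p \<in> U" for p
      using orth[OF that] c tan.pos[of "Y c p" p] unfolding tan.orthogonal_family_def by fastforce
  qed (intro smooth_fun_on_metric chart_open[OF U] vE vf[OF c])+
  then have "vector_field_on A U ?P"
    unfolding tan.proj_def by (intro vector_field_on_sum vector_field_on_scale vf)
  then have "vector_field_on A U (\<lambda>p. ?E b p + (- 1) *\<^sub>R ?P p)"
    by (intro vector_field_on_add vE vector_field_on_scale smooth_fun_on_const chart_open[OF U])
  then have vZ: "vector_field_on A U (Z c)" if "c \<in> insert b B" for c
    using vf that by (auto simp: Z_def)
  have "tan.orthogonal_family p (insert b B) (\<lambda>c. Z c p)" if p: "p \<in> U" for p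
    unfolding Z using chart_vector_notin_span[OF U p b insert.hyps(2)]
    by (intro tan.orthogonal_family_insert orth p chart_vector_tangent[OF U])
       (simp_all add: sp[OF p] insert.hyps(2))
  moreover have "span ((\<lambda>c. Z c p) ` insert b B) = span ((\<lambda>c. ?E c p) ` insert b B)" if p: "p \<in> U" for p
  proof -
    \<comment> \<open>The old and the new vector differ by an element of the span of the earlier
      ones, so exchanging them keeps the span.\<close>
    have "Z b p - ?E b p \<in> span ((\<lambda>c. Y c p) ` B)"
      using span_neg[OF tan.proj_in_span] by (simp add: Z_def)
    then have "span (insert (Z b p) ((\<lambda>c. Y c p) ` B)) = span (insert (?E b p) ((\<lambda>c. Y c p) ` B))"
      by (rule eq_span_insert_eq)
    also have "\<dots> = span (insert (?E b p) ((\<lambda>c. ?E c p) ` B))"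
      by (simp only: span_insert sp[OF p])
    finally show ?thesis by (simp only: image_insert ZB)
  qed
  ultimately show ?case
    using vZ by (intro exI[of _ Z]) blast
qed

lemma orthogonal_frame_exists:
  assumes U: "(U, \<psi>) \<in> A"
  obtains Y :: "'e \<Rightarrow> 'm vfield" where "\<And>b. b \<in> Basis \<Longrightarrow> vector_field_on A U (Y b)"
    and "\<And>p. p \<in> U \<Longrightarrow> tan.orthogonal_family p Basis (\<lambda>b. Y b p)"
    and "\<And>p. p \<in> U \<Longrightarrow> span ((\<lambda>b. Y b p) ` Basis) = tangent_space A p"
proof -
  have sp: "span ((\<lambda>b. chart_vector U \<psi> b p) ` Basis) = tangent_space A p" if "p \<in> U" for p
    by (simp only: linear_span_image[OF linear_chart_vector[OF U that]] span_Basis tangent_space_eq[OF U that])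
  obtain Y :: "'e \<Rightarrow> 'm vfield" where Y: "\<forall>b\<in>Basis. vector_field_on A U (Y b)"
    "\<forall>p\<in>U. tan.orthogonal_family p Basis (\<lambda>b. Y b p) \<and>
      span ((\<lambda>b. Y b p) ` Basis) = span ((\<lambda>b. chart_vector U \<psi> b p) ` Basis)"
    using orthogonal_frame_aux[OF U order_refl] by blast
  show ?thesis
    by (rule that[of Y]) (simp_all add: Y sp)
qed

text \<open>Riesz representation for evaluation at \<open>f\<close>, which is linear because tangent
  vectors are added and scaled pointwise.\<close>

lemma gradient_eq_frame:
  assumes "tan.orthogonal_family p I e" "span (e ` I) = tangent_space A p"
  shows "gradient A g f p = (\<Sum>i\<in>I. (e i f / g p (e i) (e i)) *\<^sub>R e i)"
  unfolding gradient_def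
  by (rule tan.riesz(1)[OF assms]) (simp add: linear_on_subspace_def scaleR_fun_apply)

text \<open>A frame around \<open>p\<close> supplies the spanning orthogonal family for
  \<open>riesz\<close>, so the description by \<open>THE\<close> in \<open>gradient\<close> is met
  at every point.\<close>

lemma gradient_tangent: "gradient A g f p \<in> tangent_space A p"
  and metric_gradient: "w \<in> tangent_space A p \<Longrightarrow> g p (gradient A g f p) w = w f"
proof -
  obtain U \<psi> where U: "(U, \<psi>) \<in> A" "p \<in> U" using exists_chart by blast
  obtain Y :: "'e \<Rightarrow> 'm vfield" where Y: "tan.orthogonal_family p Basis (\<lambda>b. Y b p)"
      "span ((\<lambda>b. Y b p) ` Basis) = tangent_space A p"
    using orthogonal_frame_exists[OF U(1)] U(2) by metis
  have l: "linear_on_subspace (tangent_space A p) (\<lambda>w. w f)"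
    by (simp add: linear_on_subspace_def scaleR_fun_apply)
  show "gradient A g f p \<in> tangent_space A p"
    unfolding gradient_eq_frame[OF Y] by (rule tan.riesz(2)[OF Y l])
  show "g p (gradient A g f p) w = w f" if "w \<in> tangent_space A p"
    unfolding gradient_eq_frame[OF Y] by (rule tan.riesz(3)[OF Y l that])
qed

lemma vector_field_gradient:
  assumes "smooth_fun_on A UNIV f"
  shows "vector_field A (gradient A g f)"
proof (rule vector_field_onI[OF gradient_tangent])
  fix V h assume V: "open V" "smooth_fun_on A V h"
  show "smooth_fun_on A V (\<lambda>p. gradient A g f p h)"
  \<comment> \<open>Frames exist only over chart domains, so smoothness is checked near each point
    of \<open>V\<close>.\<close>
  proof (rule smooth_fun_on_local)
    fix p assume p: "p \<in> V"
    obtain U \<psi> where U: "(U, \<psi>) \<in> A" "p \<in> U" using exists_chart by blast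
    obtain Y :: "'e \<Rightarrow> 'm vfield" where vf: "\<And>b. b \<in> Basis \<Longrightarrow> vector_field_on A U (Y b)"
      and orth: "\<And>p. p \<in> U \<Longrightarrow> tan.orthogonal_family p Basis (\<lambda>b. Y b p)"
      and sp: "\<And>p. p \<in> U \<Longrightarrow> span ((\<lambda>b. Y b p) ` Basis) = tangent_space A p"
      using orthogonal_frame_exists[OF U(1)] by metis
    let ?W = "U \<inter> V"
    have W: "open ?W" using chart_open[OF U(1)] V(1) by blast
    have vW: "vector_field_on A ?W (Y b)" if "b \<in> Basis" for b
      using vector_field_on_subset[OF vf[OF that]] by simp
    have "smooth_fun_on A ?W (\<lambda>q. Y b q f / g q (Y b q) (Y b q) * Y b q h)" if b: "b \<in> Basis" for b
    proof (intro smooth_fun_on_mult smooth_fun_on_divide W smooth_fun_on_metric vW b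
        vector_field_onD(2)[OF vW[OF b]] order_refl)
      show "smooth_fun_on A ?W f" using smooth_fun_on_subset[OF assms] by simp
      show "smooth_fun_on A ?W h" using smooth_fun_on_subset[OF V(2)] by simp
      show "g q (Y b q) (Y b q) \<noteq> 0" if "q \<in> ?W" for q
        using orth[of q] that b tan.pos[of "Y b q" q] unfolding tan.orthogonal_family_def by fastforce
    qed
    then have "smooth_fun_on A ?W (\<lambda>q. \<Sum>b\<in>Basis. Y b q f / g q (Y b q) (Y b q) * Y b q h)"
      by (rule smooth_fun_on_sum[OF W])
    then have "smooth_fun_on A ?W (\<lambda>q. gradient A g f q h)"
      by (rule smooth_fun_on_cong[OF W])
         (simp add: gradient_eq_frame[OF orth sp] sum_fun_apply scaleR_fun_apply)
    then show "\<exists>W. open W \<and> p \<in> W \<and> smooth_fun_on A W (\<lambda>q. gradient A g f q h)"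
      using W U(2) p by blast
  qed
qed

end

section \<open>The generalized symmetric metric connection\<close>

context apapR_manifold
begin

sublocale riemannian_manifold A g
  by unfold_locales (rule metric)

lemma xi_tangent: "\<xi> p \<in> tangent_space A p"
  using vector_field_onD(1)[OF xi_field] by simp

lemma phi_tangent: "v \<in> tangent_space A p \<Longrightarrow> \<phi> p v \<in> tangent_space A p"
  and phi_linear: "linear_on_subspace (tangent_space A p) (\<phi> p)"
  using phi_tensor unfolding tensor_field_1_1_def by blast+

text \<open>Putting \<open>\<xi>\<close> for the second vector in \<open>metric_phi\<close> makes
  the left side vanish, since \<open>\<phi> \<xi> = 0\<close>; then \<open>\<eta>(\<xi>) = 1\<close>
  gives the claim.\<close>

lemma metric_xi:
  assumes "v \<in> tangent_space A p"
  shows "g p v (\<xi> p) = \<eta> p v" "g p (\<xi> p) v = \<eta> p v"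
proof -
  show "g p v (\<xi> p) = \<eta> p v"
    using metric_phi[OF assms xi_tangent] tan.right_simps(3)[OF phi_tangent[OF assms]]
    by (simp add: phi_xi eta_xi)
  then show "g p (\<xi> p) v = \<eta> p v"
    using tan.sym[OF assms xi_tangent] by simp
qed

text \<open>This makes the choice in \<open>divergence\<close> meaningful. \<open>\<xi>\<close> can
  come first because \<open>g(\<xi>, \<xi>) = \<eta>(\<xi>) = 1\<close>, and the coordinate vectors
  form a basis of \<open>2 * n + 1\<close> elements.\<close>

lemma adapted_orthonormal_basis_exists: "\<exists>e. adapted_orthonormal_basis A n \<xi> g p e"
proof -
  obtain U \<psi> where U: "(U, \<psi>) \<in> A" "p \<in> U" using exists_chart by blast
  let ?L = "\<lambda>v. chart_vector U \<psi> v p"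
  have "independent (?L ` Basis)"
    by (intro linear_independent_injective_image linear_chart_vector U independent_Basis
        inj_on_subset[OF inj_chart_vector[OF U]] subset_UNIV)
  moreover have "card (?L ` Basis) = Suc (2 * n)"
    using card_image[OF inj_on_subset[OF inj_chart_vector[OF U]], of Basis] dimension by simp
  moreover have "span (?L ` Basis) = tangent_space A p"
    by (simp only: linear_span_image[OF linear_chart_vector[OF U]] span_Basis tangent_space_eq[OF U])
  ultimately show ?thesis
    using tan.orthonormal_basis_exists[OF xi_tangent, of p "?L ` Basis" "2 * n"]
      metric_xi(1)[OF xi_tangent] eta_xi
    unfolding adapted_orthonormal_basis_def by simp
qed

section \<open>Comparison of an affine connection with its generalized symmetric metric
  modification\<close>

context
  fixes D Dbar :: "'m connection" and \<alpha> \<beta> :: "'m \<Rightarrow> real"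
  assumes D: "affine_connection A D"
  defines "Dbar \<equiv> gen_sym_metric_connection \<phi> \<xi> \<eta> g \<alpha> \<beta> D"
begin

lemma metric_gen_sym_metric_connection:
  assumes "vector_field A Y" "v \<in> tangent_space A p" "w \<in> tangent_space A p"
  shows "g p (Dbar p v Y) w = g p (D p v Y) w
    + \<alpha> p * (g p v (Y p) * \<eta> p w - \<eta> p (Y p) * g p v w)
    + \<beta> p * (g p (\<phi> p v) (Y p) * \<eta> p w - \<eta> p (Y p) * g p (\<phi> p v) w)"
proof -
  \<comment> \<open>Additivity of \<open>g\<close> is known only on the tangent space, so every
    summand of the connection has to be tangent; for this one the smoothness of \<open>Y\<close> is
    used.\<close>
  have "D p v Y \<in> tangent_space A p"
    using D assms(1,2) unfolding affine_connection_def by blast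
  then show ?thesis
    unfolding Dbar_def gen_sym_metric_connection_def
    using assms phi_tangent[OF assms(2)] xi_tangent metric_xi(2)[OF assms(3)]
    by (simp add: tan.left_simps tan.closed)
qed

lemma divergence_gen_sym_metric_connection:
  assumes "vector_field A X"
  shows "divergence A n \<xi> g Dbar X p = divergence A n \<xi> g D X p - 2 * real n * \<alpha> p * \<eta> p (X p)"
proof -
  \<comment> \<open>The choice does not depend on the connection, so both divergences are computed
    in the same basis \<open>e\<close>.\<close>
  define e where "e = (SOME e. adapted_orthonormal_basis A n \<xi> g p e)"
  have "adapted_orthonormal_basis A n \<xi> g p e"
    unfolding e_def by (rule someI_ex[OF adapted_orthonormal_basis_exists])
  then have e0: "e 0 = \<xi> p"
    and on: "\<And>i j. i \<in> {..2*n} \<Longrightarrow> j \<in> {..2*n} \<Longrightarrow> g p (e i) (e j) = (if i = j then 1 else 0)"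
    and sp: "span (e ` {..2*n}) = tangent_space A p"
    unfolding adapted_orthonormal_basis_def by auto
  have eT: "e i \<in> tangent_space A p" if "i \<in> {..2*n}" for i
    using span_base[OF imageI[OF that], of e] unfolding sp .
  have XT: "X p \<in> tangent_space A p" using vector_field_onD(1)[OF assms] by simp
  \<comment> \<open>\<open>\<eta>\<close> is the pairing with \<open>e 0 = \<xi>\<close>, so it is 1
    on the first basis vector and 0 on the others; \<open>sum_eta\<close> uses this to pick out a
    single term.\<close>
  have eta_e: "\<eta> p (e i) = (if i = 0 then 1 else 0)" if "i \<in> {..2*n}" for i
    using on[of i 0] that metric_xi(1)[OF eT[OF that]] by (simp add: e0)
  \<comment> \<open>The vanishing trace, stated for an unspecified basis, is moved to the basis
    \<open>e\<close>.\<close>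
  have tr: "(\<Sum>i\<in>{..2*n}. g p (\<phi> p (e i)) (e i)) = 0"
    using tan.trace_on_orthonormal[OF phi_linear _ _ on sp] phi_tangent trace_phi[of p] by auto
  have sum_eta: "(\<Sum>i\<in>{..2*n}. c i * \<eta> p (e i)) = c 0" for c
  proof -
    have "(\<Sum>i\<in>{..2*n}. c i * \<eta> p (e i)) = (\<Sum>i\<in>{..2*n}. if i = 0 then c i else 0)"
      by (intro sum.cong) (auto simp: eta_e)
    then show ?thesis by simp
  qed
  have "g p (Dbar p (e i) X) (e i) = g p (D p (e i) X) (e i)
      + \<alpha> p * (g p (e i) (X p) * \<eta> p (e i) - \<eta> p (X p))
      + \<beta> p * (g p (\<phi> p (e i)) (X p) * \<eta> p (e i) - \<eta> p (X p) * g p (\<phi> p (e i)) (e i))"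
    if "i \<in> {..2*n}" for i
    using metric_gen_sym_metric_connection[OF assms eT[OF that] eT[OF that]] on[OF that that] by simp
  then have "(\<Sum>i\<in>{..2*n}. g p (Dbar p (e i) X) (e i)) = (\<Sum>i\<in>{..2*n}. g p (D p (e i) X) (e i)
      + \<alpha> p * (g p (e i) (X p) * \<eta> p (e i) - \<eta> p (X p))
      + \<beta> p * (g p (\<phi> p (e i)) (X p) * \<eta> p (e i) - \<eta> p (X p) * g p (\<phi> p (e i)) (e i)))"
    by (rule sum.cong[OF refl])
  \<comment> \<open>The range \<open>{..2*n}\<close> has \<open>2 * n + 1\<close> terms, whence the
    coefficient; the pairing of \<open>e 0\<close> with \<open>X p\<close> gives back one
    \<open>\<eta>(X)\<close>, which leaves \<open>- 2 * n\<close>.\<close>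
  also have "\<dots> = (\<Sum>i\<in>{..2*n}. g p (D p (e i) X) (e i))
      + \<alpha> p * (g p (e 0) (X p) - (2 * real n + 1) * \<eta> p (X p))
      + \<beta> p * g p (\<phi> p (e 0)) (X p)"
    by (simp add: sum.distrib sum_subtractf sum_distrib_left[symmetric] sum_eta tr)
  also have "g p (e 0) (X p) = \<eta> p (X p)"
    using metric_xi(2)[OF XT] by (simp add: e0)
  also have "g p (\<phi> p (e 0)) (X p) = 0"
    using tan.left_simps(3)[OF XT] by (simp add: e0 phi_xi)
  finally show ?thesis
    unfolding divergence_def Let_def e_def[symmetric] by (simp add: algebra_simps)
qed

text \<open>The pairing formula for the field \<open>grad f\<close>: pairing it with
  \<open>X\<close> and \<open>\<phi> X\<close> gives the derivatives of \<open>f\<close> along them,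
  and \<open>\<eta>(grad f)\<close> is \<open>\<xi> f\<close>.\<close>

lemma hessian_gen_sym_metric_connection:
  assumes "smooth_fun_on A UNIV f" "vector_field A X" "vector_field A Y"
  shows "hessian A g Dbar f X Y p = hessian A g D f X Y p
    + \<alpha> p * X p f * \<eta> p (Y p) - \<alpha> p * \<xi> p f * g p (X p) (Y p)
    + \<beta> p * \<phi> p (X p) f * \<eta> p (Y p) - \<beta> p * \<xi> p f * g p (\<phi> p (X p)) (Y p)"
proof -
  have X: "X p \<in> tangent_space A p" and Y: "Y p \<in> tangent_space A p"
    using vector_field_onD(1)[OF assms(2)] vector_field_onD(1)[OF assms(3)] by auto
  have "g p w (gradient A g f p) = w f" if "w \<in> tangent_space A p" for w
    using metric_gradient[OF that] tan.sym[OF that gradient_tangent] by simp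
  moreover have "\<eta> p (gradient A g f p) = \<xi> p f"
    using metric_xi(1)[OF gradient_tangent] metric_gradient[OF xi_tangent] by simp
  ultimately show ?thesis
    unfolding hessian_def metric_gen_sym_metric_connection[OF vector_field_gradient[OF assms(1)] X Y]
    by (simp add: X phi_tangent algebra_simps)
qed

text \<open>The divergence formula for the smooth field \<open>grad f\<close>, where
  \<open>\<eta>(grad f) = g(grad f, \<xi>) = \<xi> f\<close>.\<close>

lemma laplacian_gen_sym_metric_connection:
  assumes "smooth_fun_on A UNIV f"
  shows "laplacian A n \<xi> g Dbar f p = laplacian A n \<xi> g D f p - 2 * real n * \<alpha> p * \<xi> p f"
  using metric_xi(1)[OF gradient_tangent] metric_gradient[OF xi_tangent]
  unfolding laplacian_def
  by (simp add: divergence_gen_sym_metric_connection[OF vector_field_gradient[OF assms]])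

end

end

theorem theorem6:
  fixes A :: "('m::{t2_space, second_countable_topology}, 'e::euclidean_space) chart set"
    and n :: nat
    and \<phi> :: "'m \<Rightarrow> 'm tvec \<Rightarrow> 'm tvec"
    and \<xi> :: "'m vfield"
    and \<eta> :: "'m \<Rightarrow> 'm tvec \<Rightarrow> real"
    and g :: "'m \<Rightarrow> 'm tvec \<Rightarrow> 'm tvec \<Rightarrow> real"
    and D Dbar :: "'m connection"
    and \<alpha> \<beta> :: "'m \<Rightarrow> real"
  assumes "apapR_manifold A n \<phi> \<xi> \<eta> g"
    and "levi_civita A g D"
    and "smooth_fun_on A UNIV \<alpha>"
    and "smooth_fun_on A UNIV \<beta>"
    and "Dbar = gen_sym_metric_connection \<phi> \<xi> \<eta> g \<alpha> \<beta> D"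
  shows "(\<forall>x. vector_field A x \<longrightarrow>
            (\<forall>p. divergence A n \<xi> g Dbar x p =
                 divergence A n \<xi> g D x p - 2 * real n * \<alpha> p * \<eta> p (x p))) \<and>
         (\<forall>f x y. smooth_fun_on A UNIV f \<and> vector_field A x \<and> vector_field A y \<longrightarrow>
            (\<forall>p. hessian A g Dbar f x y p =
                 hessian A g D f x y p
                 + \<alpha> p * x p f * \<eta> p (y p) - \<alpha> p * \<xi> p f * g p (x p) (y p)
                 + \<beta> p * \<phi> p (x p) f * \<eta> p (y p) - \<beta> p * \<xi> p f * g p (\<phi> p (x p)) (y p))) \<and>
         (\<forall>f. smooth_fun_on A UNIV f \<longrightarrow>
            (\<forall>p. laplacian A n \<xi> g Dbar f p =
                 laplacian A n \<xi> g D f p - 2 * real n * \<alpha> p * \<xi> p f))"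
proof -
  interpret apapR_manifold A n \<phi> \<xi> \<eta> g by (rule assms(1))
  have D: "affine_connection A D"
    using assms(2) unfolding levi_civita_def by blast
  show ?thesis
    unfolding assms(5)
    using divergence_gen_sym_metric_connection[OF D] hessian_gen_sym_metric_connection[OF D]
      laplacian_gen_sym_metric_connection[OF D]
    by simp
qed

end
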